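(* Let $d\ge2$ be an integer and let $A\subset\mathbb{R}^{d-1}$ be a nonempty bounded open convex set. Then for every concave function $h:A\to[0,\infty)$ with $\|h\|_{L^\infty(A)}=1$ we have $$\frac{6}{(d+1)(d+2)}\ \le\ \frac{\int_A h^3(x)\,dx}{\int_A h(x)\,dx}\ \le\ 1.$$ Moreover, both inequalities are sharp. In particular, for any such $(d-1)$-dimensional convex set $A$, the right inequality is an equality if and only if $h\equiv1$, while the left inequality is an equality if and only if $h$ is a cone function on $A$.
   Context: Let $A\subset\mathbb{R}^{d-1}$ be a nonempty bounded open convex set and let $P$ be an internal point of $A$. The cone function on $A$ with vertex $P$ is the smallest concave function $h$ with values in $[0,1]$ (defined on $A$ and extended to $\partial A$) such that $h(P)=1$ and $h=0$ on $\partial A$. Its level sets are homothetic copies of $A$: for every $0\le\sigma\le1$ the set $\{h\ge\sigma\}$ is $\sigma P+(1-\sigma)A$ (up to taking the closure of $A$). A cone function on $A$ is a cone function with some vertex $P$ that is an internal point of $A$.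
   Formalization: Left equality is proved equivalent to h being a cone function with vertex in A or on the boundary of A (vertex in A if h attains 1 in A); the stated "only if" fails, e.g. for h(x)=x on A=(0,1), d=2. *)

theory Defs
  imports "HOL-Analysis.Analysis" "HOL-Probability.Essential_Supremum"
begin

text \<open>A function on \<open>A\<close> is represented by a total function of which only the values on \<open>A\<close>
  matter. The norm takes the value \<open>\<infinity>\<close> if the function is not measurable on \<open>A\<close>.\<close>

definition Linfty_norm :: "(real^'n) set \<Rightarrow> (real^'n \<Rightarrow> real) \<Rightarrow> ereal" where
  "Linfty_norm A h = esssup (lebesgue_on A) (\<lambda>x. ereal \<bar>h x\<bar>)"

definition normalized_concave :: "(real^'n) set \<Rightarrow> (real^'n \<Rightarrow> real) \<Rightarrow> bool" where
  "normalized_concave A h \<longleftrightarrow>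
     concave_on A h \<and> (\<forall>x\<in>A. 0 \<le> h x) \<and> Linfty_norm A h = 1"

definition cubic_ratio :: "(real^'n) set \<Rightarrow> (real^'n \<Rightarrow> real) \<Rightarrow> real" where
  "cubic_ratio A h = (LINT x|lebesgue_on A. h x ^ 3) / (LINT x|lebesgue_on A. h x)"

definition concave_peak :: "(real^'n) set \<Rightarrow> real^'n \<Rightarrow> (real^'n \<Rightarrow> real) \<Rightarrow> bool" where
  "concave_peak A P h \<longleftrightarrow>
     concave_on (closure A) h \<and> (\<forall>x\<in>closure A. 0 \<le> h x \<and> h x \<le> 1) \<and> h P = 1"

definition smallest_on ::
    "(real^'n) set \<Rightarrow> ((real^'n \<Rightarrow> real) \<Rightarrow> bool) \<Rightarrow> (real^'n \<Rightarrow> real) \<Rightarrow> bool" where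
  "smallest_on S C g \<longleftrightarrow> C g \<and> (\<forall>k. C k \<longrightarrow> (\<forall>x\<in>S. g x \<le> k x))"

text \<open>The cone function lives on \<open>closure A\<close>; \<open>h\<close> is only required to agree with it on \<open>A\<close>.\<close>

definition is_cone_function :: "(real^'n) set \<Rightarrow> (real^'n \<Rightarrow> real) \<Rightarrow> bool" where
  "is_cone_function A h \<longleftrightarrow>
     (\<exists>P\<in>interior A. \<exists>g.
        smallest_on (closure A) (\<lambda>k. concave_peak A P k \<and> (\<forall>x\<in>frontier A. k x = 0)) g
        \<and> (\<forall>x\<in>A. h x = g x))"

text \<open>For a vertex on the boundary the condition \<open>h = 0\<close> on the boundary contradicts \<open>h P = 1\<close>
  and is dropped; for a vertex in the interior of a bounded open convex set dropping it would
  not change the smallest function. Example: \<open>x \<mapsto> x\<close> on the interval \<open>(0, 1)\<close>, with vertex \<open>1\<close>.\<close>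

definition is_boundary_cone_function :: "(real^'n) set \<Rightarrow> (real^'n \<Rightarrow> real) \<Rightarrow> bool" where
  "is_boundary_cone_function A h \<longleftrightarrow>
     (\<exists>P\<in>frontier A. \<exists>g.
        smallest_on (closure A) (concave_peak A P) g \<and> (\<forall>x\<in>A. h x = g x))"

end

theory Submission
  imports Defs
begin

text \<open>Let \<open>h\<close> reach its supremum 1 at \<open>P\<close> in the closure of \<open>A\<close>, at least as a limit, and let
  \<open>n = d - 1\<close>. Concavity along the rays from \<open>P\<close> gives \<open>h (P + t (x - P)) \<ge> h x + (1 - t) (1 - h x)\<close>.
  Raising this to the power \<open>m\<close>, integrating over \<open>A\<close>, rescaling the left side and letting
  \<open>t \<rightarrow> 1\<close> yields \<open>(n + m) I\<^sub>m \<ge> m I\<^bsub>m-1\<^esub>\<close> for the integrals \<open>I\<^sub>m\<close> of \<open>h\<^sup>m\<close> over \<open>A\<close>; the lower bound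
  is the product of the cases \<open>m = 2\<close> and \<open>m = 3\<close>. What is lost in the case \<open>m = 2\<close> is the deviation of \<open>h\<close>
  from being affine on the rays and the mass of \<open>h\<close> near the ends of the rays; both vanish exactly
  for the cone with vertex \<open>P\<close>.\<close>

section \<open>Dilations and integrals\<close>

text \<open>The homothety with centre \<open>P\<close> and ratio \<open>t\<close>. Ratios above 1
  occur as well: they push a point outward along its ray.\<close>

definition dil :: "'a::real_vector \<Rightarrow> real \<Rightarrow> 'a \<Rightarrow> 'a" where
  "dil P t x = P + t *\<^sub>R (x - P)"

lemma dil_dil: "dil P s (dil P t x) = dil P (s * t) x"
  by (simp add: dil_def)

lemma dil_one [simp]: "dil P 1 x = x"
  by (simp add: dil_def)

lemma continuous_on_dil [continuous_intros]:
  fixes P :: "'a::real_normed_vector"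
  shows "continuous_on S (dil P t)"
  unfolding dil_def by (intro continuous_intros)

lemma mem_dil_image_iff:
  assumes "t \<noteq> 0"
  shows "x \<in> dil P t ` S \<longleftrightarrow> dil P (1 / t) x \<in> S"
proof
  assume "x \<in> dil P t ` S"
  then show "dil P (1 / t) x \<in> S"
    using assms by (auto simp: dil_dil)
next
  assume "dil P (1 / t) x \<in> S"
  moreover have "x = dil P t (dil P (1 / t) x)"
    using assms by (simp add: dil_dil)
  ultimately show "x \<in> dil P t ` S"
    by blast
qed

text \<open>The centre may be a boundary point: a segment from an interior point of a convex set to
  a point of its closure stays in the interior, except perhaps at the far end.\<close>

lemma dil_mem_open_convex:
  fixes A :: "'a::euclidean_space set"
  assumes "open A" "convex A" "P \<in> closure A" "x \<in> A" "0 < t" "t \<le> 1"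
  shows "dil P t x \<in> A"
  using mem_interior_closure_convex_shrink[OF \<open>convex A\<close> _ \<open>P \<in> closure A\<close> \<open>0 < t\<close> \<open>t \<le> 1\<close>, of x]
    assms by (simp add: interior_open dil_def algebra_simps)

text \<open>On the ray, \<open>dil P s x\<close> lies between \<open>x\<close> and
  \<open>dil P r x\<close> and differs from the latter, so it is interior even if
  \<open>dil P r x\<close> is a boundary point.\<close>

lemma dil_between:
  fixes A :: "'a::euclidean_space set"
  assumes "open A" "convex A" "x \<in> A" "dil P r x \<in> closure A" "1 \<le> s" "s < r"
  shows "dil P s x \<in> A"
proof -
  \<comment> \<open>The weight of \<open>x\<close> when \<open>dil P s x\<close> is written as a
    convex combination of \<open>x\<close> and \<open>dil P r x\<close>.\<close>
  define e where "e = (r - s) / (r - 1)"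
  have e: "0 < e" "e \<le> 1" using assms by (auto simp: e_def)
  have "e * (r - 1) = r - s"
    using assms by (simp add: e_def)
  then have es: "e + r * (1 - e) = s"
    by (simp add: algebra_simps)
  have "dil P r x - e *\<^sub>R (dil P r x - x) = P + (e + r * (1 - e)) *\<^sub>R (x - P)"
    by (simp add: dil_def algebra_simps)
  then have "dil P s x = dil P r x - e *\<^sub>R (dil P r x - x)"
    by (simp add: es dil_def)
  moreover have "dil P r x - e *\<^sub>R (dil P r x - x) \<in> interior A"
    using assms e by (intro mem_interior_closure_convex_shrink) (auto simp: interior_open)
  ultimately show ?thesis
    using interior_subset by auto
qed

section \<open>Continuity, null sets and change of variables\<close>

lemma concave_on_continuous_open:
  fixes A :: "'a::euclidean_space set"
  assumes "open A" "concave_on A h"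
  shows "continuous_on A h"
  using continuous_on_minus[OF convex_on_continuous[OF assms(1), of "\<lambda>x. - h x"]] assms(2)
  by (simp add: concave_on_def)

lemma open_eq_empty_if_AE_notin:
  fixes U :: "'a::euclidean_space set"
  assumes "open U" "AE x in lborel. x \<notin> U"
  shows "U = {}"
proof -
  have "U \<in> null_sets lborel"
    using assms AE_iff_null_sets[of U lborel] by simp
  then have "negligible U"
    by (auto simp: negligible_iff_null_sets null_sets_completion_iff2)
  then show ?thesis
    using open_not_negligible[OF \<open>open U\<close>] by blast
qed

lemma set_integrable_bounded_continuous:
  fixes f :: "'a::euclidean_space \<Rightarrow> real"
  assumes "A \<in> sets borel" "bounded A" "continuous_on A f" "\<And>x. x \<in> A \<Longrightarrow> \<bar>f x\<bar> \<le> B"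
  shows "set_integrable lborel A f"
proof (rule set_integrable_bound[where f = "\<lambda>_. B"])
  show "set_integrable lborel A (\<lambda>_. B)"
    using assms emeasure_bounded_finite[OF \<open>bounded A\<close>]
    unfolding set_integrable_def by (intro integrable_scaleR_left) (auto simp: top.not_eq_extremum)
  show "set_borel_measurable lborel A f"
    using borel_measurable_continuous_on_indicator[OF assms(1,3)]
    by (simp add: set_borel_measurable_def)
  have "\<bar>f x\<bar> \<le> \<bar>B\<bar>" if "x \<in> A" for x
    using assms(4)[OF that] by simp
  then show "AE x in lborel. x \<in> A \<longrightarrow> norm (f x) \<le> norm B"
    by simp
qed

text \<open>Change of variables for a homothety, with Jacobian \<open>t ^ DIM('a)\<close>.\<close>

lemma set_integral_dil_image:
  fixes f :: "'a::euclidean_space \<Rightarrow> real"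
  assumes "A \<in> sets borel" "continuous_on (dil P t ` A) f" "0 < t"
  shows "(LINT x:dil P t ` A|lborel. f x) = t ^ DIM('a) * (LINT x:A|lborel. f (dil P t x))"
proof -
  let ?F = "\<lambda>x. indicator (dil P t ` A) x *\<^sub>R f x"
  let ?T = "\<lambda>x. (P - t *\<^sub>R P) + t *\<^sub>R x"
  have T: "?T x = dil P t x" for x
    by (simp add: dil_def algebra_simps)
  have im: "dil P t ` A = dil P (1 / t) -` A"
    using \<open>0 < t\<close> mem_dil_image_iff[of t _ P A] by auto
  have "dil P (1 / t) \<in> borel_measurable borel"
    by (intro borel_measurable_continuous_onI continuous_intros)
  then have mA: "dil P t ` A \<in> sets borel"
    unfolding im using assms(1) measurable_sets_borel by blast
  have mF: "?F \<in> borel_measurable borel"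
    by (rule borel_measurable_continuous_on_indicator[OF mA assms(2)])
  have ind: "indicator (dil P t ` A) (dil P t x) = (indicator A x :: real)" for x
    using \<open>0 < t\<close> by (auto simp: im dil_dil indicator_def)
  have "integral\<^sup>L lborel ?F = integral\<^sup>L (density (distr lborel borel ?T) (\<lambda>_. \<bar>t\<bar> ^ DIM('a))) ?F"
    using lborel_affine[of t "P - t *\<^sub>R P"] \<open>0 < t\<close> by simp
  also have "\<dots> = integral\<^sup>L (distr lborel borel ?T) (\<lambda>x. \<bar>t\<bar> ^ DIM('a) *\<^sub>R ?F x)"
    using mF by (intro integral_density) auto
  also have "\<dots> = integral\<^sup>L lborel (\<lambda>x. \<bar>t\<bar> ^ DIM('a) *\<^sub>R ?F (?T x))"
    using mF by (intro integral_distr) auto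
  also have "\<dots> = t ^ DIM('a) * integral\<^sup>L lborel (\<lambda>x. indicator A x *\<^sub>R f (dil P t x))"
    using \<open>0 < t\<close> by (simp add: T ind)
  finally show ?thesis
    by (simp add: set_lebesgue_integral_def)
qed

text \<open>The set where \<open>f\<close> is positive is open and null, hence empty. This turns
  equality of integrals into equality at every point, as the equality cases demand.\<close>

lemma continuous_set_integral_eq_0:
  fixes f :: "'a::euclidean_space \<Rightarrow> real"
  assumes "open A" "continuous_on A f" "set_integrable lborel A f"
    and nn: "\<And>x. x \<in> A \<Longrightarrow> 0 \<le> f x" and "(LINT x:A|lborel. f x) = 0" "x \<in> A"
  shows "f x = 0"
proof -
  have "AE y in lborel. indicator A y *\<^sub>R f y = 0"
    using integral_nonneg_eq_0_iff_AE[of lborel "\<lambda>y. indicator A y *\<^sub>R f y"] assms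
    by (auto simp: set_integrable_def set_lebesgue_integral_def indicator_def)
  then have "AE y in lborel. y \<notin> {y \<in> A. 0 < f y}"
    by eventually_elim (auto simp: indicator_def)
  moreover have "open {y \<in> A. 0 < f y}"
    using continuous_open_preimage[OF assms(2,1) open_greaterThan[of 0]]
    by (simp add: vimage_def Int_def conj_commute)
  ultimately have "{y \<in> A. 0 < f y} = {}"
    by (intro open_eq_empty_if_AE_notin)
  then show ?thesis
    using nn[OF \<open>x \<in> A\<close>] \<open>x \<in> A\<close> by force
qed

section \<open>Tangent bounds for powers\<close>

text \<open>The convex function \<open>x ^ m\<close> lies above its tangent at \<open>a\<close>. For
  \<open>m = 0\<close> the factor \<open>real m\<close> cancels the truncated exponent
  \<open>m - 1\<close>.\<close>

lemma power_add_lower: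
  fixes a b :: real
  assumes "0 \<le> a" "0 \<le> b"
  shows "a ^ m + real m * a ^ (m - 1) * b \<le> (a + b) ^ m"
proof (induction m)
  case (Suc m)
  have "a ^ Suc m + real (Suc m) * a ^ m * b \<le> (a + b) * (a ^ m + real m * a ^ (m - 1) * b)"
    using assms by (cases m) (auto simp: algebra_simps)
  also have "\<dots> \<le> (a + b) * (a + b) ^ m"
    using Suc assms by (intro mult_left_mono) auto
  finally show ?case by simp
qed simp

text \<open>The same convexity, with the tangent at \<open>a + b\<close> evaluated at
  \<open>a\<close>.\<close>

lemma power_add_upper:
  fixes a b :: real
  assumes "0 \<le> a" "0 \<le> b"
  shows "(a + b) ^ m \<le> a ^ m + real m * (a + b) ^ (m - 1) * b"
proof (induction m)
  case (Suc m)
  have "(a + b) * (a + b) ^ m = a * (a + b) ^ m + b * (a + b) ^ m"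
    by (simp add: algebra_simps)
  also have "\<dots> \<le> a * (a ^ m + real m * (a + b) ^ (m - 1) * b) + b * (a + b) ^ m"
    using Suc assms by (intro add_right_mono mult_left_mono) auto
  also have "\<dots> \<le> a ^ Suc m + real (Suc m) * (a + b) ^ m * b"
  proof -
    have "a * (real m * (a + b) ^ (m - 1) * b) \<le> (a + b) * (real m * (a + b) ^ (m - 1) * b)"
      using assms by (intro mult_right_mono) auto
    also have "\<dots> = real m * (a + b) ^ m * b"
      by (cases m) auto
    finally show ?thesis by (simp add: algebra_simps)
  qed
  finally show ?case by simp
qed simp

section \<open>Moments of a concave function with a peak\<close>

text \<open>\<open>h_dil\<close> is concavity on the segment from \<open>P\<close> to
  \<open>x\<close> with the value 1 at \<open>P\<close>. It avoids the number \<open>h P\<close>,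
  which says nothing about \<open>h\<close> on \<open>A\<close> when \<open>P\<close> lies on the
  boundary.\<close>

locale peaked_concave =
  fixes A :: "'a::euclidean_space set" and P :: 'a and h :: "'a \<Rightarrow> real"
  assumes open_A: "open A" and bounded_A: "bounded A" and nonempty_A: "A \<noteq> {}"
    and P_closure: "P \<in> closure A"
    and concave_h: "concave_on A h"
    and h_nonneg: "x \<in> A \<Longrightarrow> 0 \<le> h x" and h_le_1: "x \<in> A \<Longrightarrow> h x \<le> 1"
    and h_dil: "x \<in> A \<Longrightarrow> 0 < t \<Longrightarrow> t < 1 \<Longrightarrow> 1 - t + t * h x \<le> h (dil P t x)"
begin

lemma convex_A: "convex A"
  using concave_h by (rule concave_on_imp_convex)

lemma continuous_h [continuous_intros]: "continuous_on A h"
  using open_A concave_h by (rule concave_on_continuous_open)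

lemma dil_mem: "x \<in> A \<Longrightarrow> 0 < t \<Longrightarrow> t \<le> 1 \<Longrightarrow> dil P t x \<in> A"
  using dil_mem_open_convex[OF open_A convex_A P_closure] .

text \<open>Since \<open>A\<close> is open, \<open>x\<close> is the image of a slightly more distant
  point of \<open>A\<close> under a homothety with ratio \<open>t < 1\<close>, and
  \<open>h_dil\<close> gives at least \<open>1 - t\<close> there.\<close>

lemma h_pos:
  assumes "x \<in> A"
  shows "0 < h x"
proof -
  have "eventually (\<lambda>t. dil P (1 / t) x \<in> A) (at_left 1)"
  proof -
    have "((\<lambda>t. dil P (1 / t) x) \<longlongrightarrow> dil P (1 / 1) x) (at_left 1)"
      unfolding dil_def by (intro tendsto_intros) auto
    then show ?thesis
      using topological_tendstoD[OF _ open_A] assms by auto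
  qed
  moreover have "eventually (\<lambda>t::real. 0 < t \<and> t < 1) (at_left 1)"
    using eventually_at_left_real[of 0 1] by (auto elim: eventually_mono)
  ultimately have "eventually (\<lambda>t. 0 < t \<and> t < 1 \<and> dil P (1 / t) x \<in> A) (at_left (1::real))"
    by eventually_elim simp
  then obtain t :: real where t: "0 < t" "t < 1" "dil P (1 / t) x \<in> A"
    using eventually_happens'[of "at_left (1::real)"] by auto
  have "0 < 1 - t + t * h (dil P (1 / t) x)"
    using t h_nonneg by (simp add: add_pos_nonneg)
  also have "\<dots> \<le> h x"
    using h_dil[OF t(3,1,2)] t by (simp add: dil_dil)
  finally show ?thesis .
qed

lemma sets_A [measurable, simp]: "A \<in> sets borel"
  using open_A by simp

lemma continuous_h_dil [continuous_intros]:
  assumes "0 < t" "t \<le> 1"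
  shows "continuous_on A (\<lambda>x. h (dil P t x))"
proof -
  have "continuous_on (dil P t ` A) h"
    using assms dil_mem by (intro continuous_on_subset[OF continuous_h]) auto
  then show ?thesis
    using continuous_on_compose2[OF _ continuous_on_dil, of "dil P t ` A" h] by auto
qed

lemma integrable_moment: "set_integrable lborel A (\<lambda>x. h x ^ m)"
  using h_nonneg h_le_1
  by (intro set_integrable_bounded_continuous[where B = 1] bounded_A continuous_intros)
     (auto simp: power_le_one)

text \<open>The integral \<open>I\<^sub>m\<close> of the overview; \<open>moment 0\<close> is the
  volume of \<open>A\<close>.\<close>

definition moment :: "nat \<Rightarrow> real" where
  "moment m = (LINT x:A|lborel. h x ^ m)"

lemma moment_pos: "0 < moment m"
proof -
  have "0 \<le> moment m"
    unfolding moment_def set_lebesgue_integral_def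
    using h_nonneg by (intro Bochner_Integration.integral_nonneg) (auto simp: indicator_def)
  moreover have "moment m \<noteq> 0"
  proof
    assume "moment m = 0"
    obtain x where "x \<in> A" using nonempty_A by blast
    have "h x ^ m = 0"
      using continuous_set_integral_eq_0[of A "\<lambda>x. h x ^ m" x] open_A integrable_moment[of m]
        h_nonneg \<open>moment m = 0\<close> \<open>x \<in> A\<close> by (auto simp: moment_def intro: continuous_intros)
    then show False
      using h_pos[OF \<open>x \<in> A\<close>] by simp
  qed
  ultimately show ?thesis by simp
qed

lemma open_dil_image:
  assumes "0 < t" "open S"
  shows "open (dil P t ` S)"
proof -
  have "dil P t ` S = dil P (1 / t) -` S"
    using assms(1) mem_dil_image_iff[of t _ P S] by auto
  then show ?thesis
    using open_vimage[OF \<open>open S\<close> continuous_on_dil[of UNIV P "1/t"]] by simp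
qed

lemma dil_image_subset: "0 < t \<Longrightarrow> t \<le> 1 \<Longrightarrow> dil P t ` A \<subseteq> A"
  using dil_mem by auto

lemma set_integrable_subset_A:
  assumes "S \<in> sets borel" "S \<subseteq> A"
  shows "set_integrable lborel S (\<lambda>x. h x ^ m)"
  using set_integrable_subset[OF integrable_moment] assms by simp

lemma set_integrable_const_A:
  fixes c :: real
  assumes "S \<in> sets borel" "S \<subseteq> A"
  shows "set_integrable lborel S (\<lambda>_. c)"
  using assms bounded_subset[OF bounded_A]
  by (intro set_integrable_bounded_continuous[where B = "\<bar>c\<bar>"]) auto

text \<open>Cut \<open>A\<close> into its shrunken copy and the remaining layer, then rescale the
  copy back to \<open>A\<close>.\<close>

lemma moment_split:
  assumes "0 < t" "t \<le> 1"
  shows "moment m = t ^ DIM('a) * (LINT x:A|lborel. h (dil P t x) ^ m)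
      + (LINT x:A - dil P t ` A|lborel. h x ^ m)"
proof -
  have sets: "dil P t ` A \<in> sets borel"
    using open_dil_image[OF \<open>0 < t\<close> open_A] by simp
  have "A = dil P t ` A \<union> (A - dil P t ` A)"
    using dil_image_subset[OF assms] by auto
  then have "moment m = (LINT x:dil P t ` A \<union> (A - dil P t ` A)|lborel. h x ^ m)"
    unfolding moment_def by simp
  also have "\<dots> = (LINT x:dil P t ` A|lborel. h x ^ m) + (LINT x:A - dil P t ` A|lborel. h x ^ m)"
    using sets dil_image_subset[OF assms]
    by (intro set_integral_Un set_integrable_subset_A) auto
  also have "(LINT x:dil P t ` A|lborel. h x ^ m) = t ^ DIM('a) * (LINT x:A|lborel. h (dil P t x) ^ m)"
    using assms dil_image_subset[OF assms]
    by (intro set_integral_dil_image continuous_intros continuous_on_subset[OF continuous_h]) auto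
  finally show ?thesis .
qed

section \<open>The excess over affine behaviour on rays\<close>

text \<open>The gap between \<open>h\<close> and the affine function on the ray that takes the
  values 1 at \<open>P\<close> and \<open>h x\<close> at \<open>x\<close>, measured at
  \<open>dil P t x\<close>.\<close>

definition excess :: "real \<Rightarrow> 'a \<Rightarrow> real" where
  "excess t x = h (dil P t x) - (1 - t + t * h x)"

lemma excess_nonneg: "x \<in> A \<Longrightarrow> 0 < t \<Longrightarrow> t < 1 \<Longrightarrow> 0 \<le> excess t x"
  using h_dil by (simp add: excess_def)

lemma excess_le_1:
  assumes "x \<in> A" "0 < t" "t < 1"
  shows "excess t x \<le> 1"
proof -
  have "0 \<le> t * h x"
    using assms h_nonneg by simp
  moreover have "h (dil P t x) \<le> 1"
    using assms by (intro h_le_1 dil_mem) auto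
  ultimately show ?thesis
    using assms by (simp add: excess_def)
qed

text \<open>As a function of the ratio, the excess is concave and vanishes at 1, so its quotient by
  \<open>1 - t\<close> is nondecreasing in \<open>t\<close>.\<close>

lemma excess_mono:
  assumes "x \<in> A" "0 < s" "s \<le> t" "t < 1"
  shows "(1 - t) * excess s x \<le> (1 - s) * excess t x"
proof -
  \<comment> \<open>The weight of \<open>dil P s x\<close> when \<open>dil P t x\<close> is written
    as a convex combination of \<open>dil P s x\<close> and \<open>x\<close>.\<close>
  define l where "l = (1 - t) / (1 - s)"
  have l: "0 \<le> l" "l \<le> 1" and l_eq: "(1 - s) * l = 1 - t"
    using assms by (auto simp: l_def divide_simps)
  have t: "t = l * s + (1 - l)"
    using l_eq by (simp add: algebra_simps)
  have "dil P t x = l *\<^sub>R dil P s x + (1 - l) *\<^sub>R x"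
    unfolding dil_def t by (simp add: algebra_simps)
  moreover have "h (l *\<^sub>R dil P s x + (1 - l) *\<^sub>R x) \<ge> l * h (dil P s x) + (1 - l) * h x"
    using concave_h l assms dil_mem[of x s] unfolding concave_on_iff by simp
  ultimately have "l * h (dil P s x) + (1 - l) * h x \<le> h (dil P t x)"
    by simp
  moreover have "l * excess s x = l * h (dil P s x) - (1 - t) - (t - (1 - l)) * h x"
    using t l_eq by (simp add: excess_def algebra_simps)
  ultimately have "l * excess s x \<le> excess t x"
    unfolding excess_def by (simp add: algebra_simps)
  then have "(1 - s) * (l * excess s x) \<le> (1 - s) * excess t x"
    using assms by (intro mult_left_mono) auto
  then show ?thesis
    by (simp add: mult.assoc[symmetric] l_eq)
qed

text \<open>The factor \<open>h x ^ (m - 1)\<close> is the one that the tangent of the power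
  \<open>m\<close> at \<open>h x\<close> puts on an increment of \<open>h x\<close>.\<close>

definition weighted_excess :: "nat \<Rightarrow> real \<Rightarrow> real" where
  "weighted_excess m t = (LINT x:A|lborel. h x ^ (m - 1) * excess t x)"

lemma continuous_excess [continuous_intros]:
  assumes "0 < t" "t < 1"
  shows "continuous_on A (excess t)"
  unfolding excess_def using assms by (intro continuous_intros) auto

lemma integrable_weighted_excess:
  assumes "0 < t" "t < 1"
  shows "set_integrable lborel A (\<lambda>x. h x ^ m * excess t x)"
proof (rule set_integrable_bounded_continuous[where B = 1])
  show "\<bar>h x ^ m * excess t x\<bar> \<le> 1" if "x \<in> A" for x
    using that assms h_nonneg h_le_1 excess_nonneg excess_le_1
    by (simp add: abs_mult mult_le_one power_le_one)
qed (use assms bounded_A in \<open>auto intro!: continuous_intros\<close>)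

lemma weighted_excess_mono:
  assumes "0 < s" "s \<le> t" "t < 1"
  shows "(1 - t) * weighted_excess m s \<le> (1 - s) * weighted_excess m t"
proof -
  have "(LINT x:A|lborel. (1 - t) * (h x ^ (m - 1) * excess s x))
      \<le> (LINT x:A|lborel. (1 - s) * (h x ^ (m - 1) * excess t x))"
  proof (intro set_integral_mono set_integrable_mult_right integrable_weighted_excess)
    fix x assume "x \<in> A"
    then show "(1 - t) * (h x ^ (m - 1) * excess s x) \<le> (1 - s) * (h x ^ (m - 1) * excess t x)"
      using mult_left_mono[OF excess_mono[OF _ assms], of x "h x ^ (m - 1)"] h_nonneg
      by (simp add: mult_ac)
  qed (use assms in auto)
  then show ?thesis
    by (simp add: weighted_excess_def)
qed

text \<open>The tangent bound \<open>power_add_lower\<close> is applied to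
  \<open>h (dil P t x) ^ m\<close>, integrated over \<open>A\<close>, and inserted into
  \<open>moment_split\<close>.\<close>

lemma moment_lower:
  assumes "0 < m" "0 < t" "t < 1"
  shows "t ^ DIM('a) * (moment m + real m * ((1 - t) * (moment (m - 1) - moment m) + weighted_excess m t))
      + (LINT x:A - dil P t ` A|lborel. h x ^ m) \<le> moment m"
proof -
  let ?g = "\<lambda>x. h x ^ m + real m * ((1 - t) * (h x ^ (m - 1) - h x ^ m) + h x ^ (m - 1) * excess t x)"
  note int = integrable_moment integrable_weighted_excess[OF assms(2,3)]
  have G: "(LINT x:A|lborel. ?g x)
      = moment m + real m * ((1 - t) * (moment (m - 1) - moment m) + weighted_excess m t)"
    unfolding moment_def weighted_excess_def
    by (simp add: int set_integral_add set_integral_diff)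
  have "(LINT x:A|lborel. ?g x) \<le> (LINT x:A|lborel. h (dil P t x) ^ m)"
  proof (rule set_integral_mono)
    show "set_integrable lborel A ?g"
      using int by (intro set_integral_add set_integral_diff set_integrable_mult_right)
    show "set_integrable lborel A (\<lambda>x. h (dil P t x) ^ m)"
      using assms h_nonneg h_le_1 dil_mem
      by (intro set_integrable_bounded_continuous[where B = 1] bounded_A continuous_intros)
         (auto simp: power_le_one)
    fix x assume x: "x \<in> A"
    \<comment> \<open>The increment from \<open>h x\<close> to \<open>h (dil P t x)\<close>, split
      into its affine part and the excess.\<close>
    let ?b = "(1 - t) * (1 - h x) + excess t x"
    have "h x ^ m = h x ^ (m - 1) * h x"
      using \<open>0 < m\<close> by (simp add: power_eq_if)
    then have "?g x = h x ^ m + real m * h x ^ (m - 1) * ?b"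
      by (simp add: algebra_simps)
    also have "\<dots> \<le> (h x + ?b) ^ m"
      using assms x h_nonneg h_le_1 excess_nonneg by (intro power_add_lower) auto
    also have "h x + ?b = h (dil P t x)"
      by (simp add: excess_def algebra_simps)
    finally show "?g x \<le> h (dil P t x) ^ m" .
  qed
  then have "t ^ DIM('a) * (moment m + real m * ((1 - t) * (moment (m - 1) - moment m) + weighted_excess m t))
      \<le> t ^ DIM('a) * (LINT x:A|lborel. h (dil P t x) ^ m)"
    unfolding G using assms by (intro mult_left_mono) auto
  then show ?thesis
    using moment_split[of t m] assms by linarith
qed

text \<open>The inequality \<open>moment_lower\<close> divided by \<open>1 - t\<close>, in the limit \<open>t \<rightarrow> 1\<close>. The excess survives the
  limit because, by concavity along rays, \<open>excess t x / (1 - t)\<close> increases with \<open>t\<close>.\<close>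

lemma moment_deficit:
  assumes "0 < m" "0 < s" "s < 1"
    and \<kappa>: "\<And>t. 0 < t \<Longrightarrow> t < 1 \<Longrightarrow> (1 - t ^ DIM('a)) * \<kappa> \<le> (LINT x:A - dil P t ` A|lborel. h x ^ m)"
  shows "real m * (weighted_excess m s / (1 - s)) + real DIM('a) * \<kappa>
    \<le> (real DIM('a) + real m) * moment m - real m * moment (m - 1)"
proof -
  \<comment> \<open>This is \<open>1 - t ^ DIM('a)\<close> divided by \<open>1 - t\<close>; its
    value \<open>DIM('a)\<close> at \<open>t = 1\<close> is the source of the dimension in the
    result.\<close>
  let ?S = "\<lambda>t::real. \<Sum>i<DIM('a). t ^ i"
  let ?L = "\<lambda>t. t ^ DIM('a) * (real m * (weighted_excess m s / (1 - s))) + ?S t * \<kappa>"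
  let ?R = "\<lambda>t. ?S t * moment m - t ^ DIM('a) * (real m * (moment (m - 1) - moment m))"
  have "?L t \<le> ?R t" if t: "s < t" "t < 1" for t
  proof -
    have S: "1 - t ^ DIM('a) = (1 - t) * ?S t"
      by (rule one_diff_power_eq)
    \<comment> \<open>The excess at \<open>t\<close> is replaced by the one at the fixed ratio
      \<open>s\<close>, so that both sides have a limit.\<close>
    have "(1 - t) * (weighted_excess m s / (1 - s)) \<le> weighted_excess m t"
      using weighted_excess_mono[of s t m] assms t by (simp add: field_simps)
    then have "t ^ DIM('a) * (real m * ((1 - t) * (weighted_excess m s / (1 - s))))
        \<le> t ^ DIM('a) * (real m * weighted_excess m t)"
      using assms t by (intro mult_left_mono) auto
    moreover have "(1 - t) * ?S t * \<kappa> \<le> (LINT x:A - dil P t ` A|lborel. h x ^ m)"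
      using \<kappa>[of t] assms t unfolding S by simp
    moreover have "(1 - t) * ?S t * moment m = moment m - t ^ DIM('a) * moment m"
      unfolding S[symmetric] by (simp add: algebra_simps)
    ultimately have "(1 - t) * ?L t \<le> (1 - t) * ?R t"
      using moment_lower[of m t] assms t by (simp add: algebra_simps)
    then show ?thesis
      using t by simp
  qed
  then have "eventually (\<lambda>t. ?L t \<le> ?R t) (at_left 1)"
    using eventually_at_left_real[OF \<open>s < 1\<close>] by (auto elim!: eventually_mono)
  moreover have "(?L \<longlongrightarrow> ?L 1) (at_left 1)" "(?R \<longlongrightarrow> ?R 1) (at_left 1)"
    by (intro tendsto_intros)+
  ultimately have "?L 1 \<le> ?R 1"
    by (intro tendsto_le[of "at_left (1::real)" ?R _ ?L]) auto
  then show ?thesis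
    by (simp add: algebra_simps)
qed

lemma weighted_excess_nonneg: "0 < t \<Longrightarrow> t < 1 \<Longrightarrow> 0 \<le> weighted_excess m t"
  unfolding weighted_excess_def set_lebesgue_integral_def
  using h_nonneg excess_nonneg by (intro Bochner_Integration.integral_nonneg) (auto simp: indicator_def)

lemma remainder_nonneg: "0 \<le> (LINT x:A - S|lborel. h x ^ m)"
  unfolding set_lebesgue_integral_def
  using h_nonneg by (intro Bochner_Integration.integral_nonneg) (auto simp: indicator_def)

text \<open>\<open>moment_deficit\<close> with both losses dropped: \<open>\<kappa> = 0\<close>, and
  the nonnegative excess at the arbitrary ratio 1/2.\<close>

lemma moment_recursion:
  assumes "0 < m"
  shows "real m * moment (m - 1) \<le> (real DIM('a) + real m) * moment m"
proof -
  have "0 \<le> real m * (weighted_excess m (1/2) / (1 - 1/2))"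
    using weighted_excess_nonneg[of "1/2" m] by simp
  then show ?thesis
    using moment_deficit[of m "1/2" 0] remainder_nonneg assms by simp
qed

end

section \<open>The extremal case\<close>

text \<open>The cone with vertex \<open>P\<close>, described without boundary values:
  \<open>h\<close> is affine on rays from \<open>P\<close>, and the second clause encodes that it
  tends to 0 where a ray leaves \<open>A\<close>. A cone whose ray through \<open>x\<close> ended at
  \<open>dil P (1 / t) x\<close> would have the value \<open>1 - t\<close> at
  \<open>x\<close>.\<close>

definition conelike :: "'a::euclidean_space set \<Rightarrow> 'a \<Rightarrow> ('a \<Rightarrow> real) \<Rightarrow> bool" where
  "conelike A P h \<longleftrightarrow>
     (\<forall>x\<in>A. \<forall>t. 0 < t \<longrightarrow> t < 1 \<longrightarrow> h (dil P t x) = 1 - t + t * h x) \<and>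
     (\<forall>x\<in>A. \<forall>t. 0 < t \<longrightarrow> t < 1 \<longrightarrow> dil P (1 / t) x \<notin> A \<longrightarrow> h x \<le> 1 - t)"

context peaked_concave
begin

text \<open>Equality leaves no room for the integrated excess; being continuous and weighted by a
  positive function, the excess is then 0 at every point.\<close>

lemma affine_if_extremal:
  assumes "0 < m" and eq: "(real DIM('a) + real m) * moment m = real m * moment (m - 1)"
    and "x \<in> A" "0 < t" "t < 1"
  shows "h (dil P t x) = 1 - t + t * h x"
proof -
  have "real m * (weighted_excess m t / (1 - t)) \<le> 0"
    using moment_deficit[of m t 0] assms remainder_nonneg by simp
  then have "weighted_excess m t \<le> 0"
    using assms by (simp add: mult_le_0_iff divide_le_0_iff)
  then have "(LINT x:A|lborel. h x ^ (m - 1) * excess t x) = 0"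
    using weighted_excess_nonneg[of t m] assms by (simp add: weighted_excess_def)
  moreover have "continuous_on A (\<lambda>x. h x ^ (m - 1) * excess t x)"
    using assms by (intro continuous_intros)
  ultimately have "h x ^ (m - 1) * excess t x = 0"
    using continuous_set_integral_eq_0[of A "\<lambda>x. h x ^ (m - 1) * excess t x" x] open_A assms
      integrable_weighted_excess excess_nonneg h_nonneg by auto
  then show ?thesis
    using h_pos[OF \<open>x \<in> A\<close>] by (simp add: excess_def)
qed

text \<open>If \<open>h\<close> stays above \<open>\<epsilon>\<close> on a nonempty truncated cone reaching the boundary of \<open>A\<close>, then
  \<open>A - dil P t ` A\<close> carries mass of order \<open>1 - t\<close>, which the extremal case does not allow.\<close>

lemma vanishing_if_extremal:
  assumes "0 < m" and eq: "(real DIM('a) + real m) * moment m = real m * moment (m - 1)"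
    and x0: "x0 \<in> A" and s0: "1 < s0" "dil P s0 x0 \<notin> A"
  shows "1 \<le> s0 * (1 - h x0)"
proof (rule ccontr)
  assume "\<not> 1 \<le> s0 * (1 - h x0)"
  then have lt1: "s0 * (1 - h x0) < 1" by simp
  \<comment> \<open>The point \<open>dil P s0 x0\<close> may still lie on the boundary. A slightly
    larger ratio \<open>r\<close> leaves the closure and keeps the strict inequality, with room for
    \<open>l\<close>.\<close>
  have "((\<lambda>r. r * (1 - h x0)) \<longlongrightarrow> s0 * (1 - h x0)) (at_right s0)"
    by (intro tendsto_intros)
  then have "eventually (\<lambda>r. r * (1 - h x0) < 1) (at_right s0)"
    using lt1 by (rule order_tendstoD)
  then have "eventually (\<lambda>r. s0 < r \<and> r * (1 - h x0) < 1) (at_right s0)"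
    by (rule eventually_conj[OF eventually_at_right_less])
  then obtain r where r: "s0 < r" "r * (1 - h x0) < 1"
    using eventually_happens'[of "at_right s0"] by auto
  obtain l where l: "r * (1 - h x0) < l" "l < 1"
    using dense[OF r(2)] by blast
  \<comment> \<open>The number \<open>s * (1 - h x)\<close> is 1 minus the value at
    \<open>dil P s x\<close> of the affine continuation of \<open>h\<close> along the ray. So
    \<open>V\<close> consists of rays on which this continuation exceeds \<open>1 - l\<close> at
    some point outside the closure; excluding the closure, not just \<open>A\<close>, makes
    \<open>V\<close> open.\<close>
  define V where "V = (\<Union>s\<in>{0<..}. {x\<in>A. dil P s x \<notin> closure A} \<inter> {x\<in>A. s * (1 - h x) < l})"
  have "open V"
  proof -
    have "open {x\<in>A. dil P s x \<notin> closure A}" for s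
      using continuous_open_preimage[OF continuous_on_dil[of A P s] open_A, of "- closure A"]
      by (simp add: vimage_def Int_def conj_commute open_Compl)
    moreover have "open {x\<in>A. s * (1 - h x) < l}" for s
      using continuous_open_preimage[of A "\<lambda>x. s * (1 - h x)" "{..<l}"] open_A
      by (simp add: vimage_def Int_def conj_commute continuous_intros)
    ultimately show ?thesis
      unfolding V_def by auto
  qed
  have "V \<subseteq> A" by (auto simp: V_def)
  have "x0 \<in> V"
    using x0 l r s0 dil_between[OF open_A convex_A x0 _ _ r(1)] unfolding V_def by (auto intro!: bexI[of _ r])
  have h_V: "1 - l \<le> h x" if xV: "x \<in> V" for x
  proof -
    obtain s where s: "0 < s" "x \<in> A" "dil P s x \<notin> closure A" "s * (1 - h x) < l"
      using xV by (auto simp: V_def)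
    have "1 < s"
      using dil_mem[of x s] s closure_subset by (meson not_le subsetD)
    then have "1 * (1 - h x) \<le> s * (1 - h x)"
      using h_le_1[OF s(2)] by (intro mult_right_mono) auto
    then show ?thesis using s by simp
  qed
  have affine: "h (dil P t x) = 1 - t + t * h x" if "x \<in> A" "0 < t" "t < 1" for x t
    using affine_if_extremal[OF assms(1,2) that] .
  \<comment> \<open>By affinity on rays, moving from \<open>x\<close> to \<open>dil P t x\<close>
    and from \<open>s\<close> to \<open>s / t\<close> preserves both conditions, so membership in
    \<open>V\<close> depends only on the ray.\<close>
  have V_dil: "dil P t x \<in> V \<longleftrightarrow> x \<in> V" if "x \<in> A" "0 < t" "t < 1" for x t
  proof -
    have *: "(s / t) * (1 - h (dil P t x)) = s * (1 - h x)" for s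
      using that by (simp add: affine field_simps)
    show ?thesis
    proof
      assume "dil P t x \<in> V"
      then obtain s where s: "0 < s" "dil P (s * t) x \<notin> closure A" "s * (1 - h (dil P t x)) < l"
        by (auto simp: V_def dil_dil)
      then show "x \<in> V"
        using *[of "s * t"] that unfolding V_def by (auto intro!: bexI[of _ "s * t"])
    next
      assume "x \<in> V"
      then obtain s where s: "0 < s" "dil P s x \<notin> closure A" "s * (1 - h x) < l"
        by (auto simp: V_def)
      then show "dil P t x \<in> V"
        using *[of s] that dil_mem[of x t] unfolding V_def
        by (auto intro!: bexI[of _ "s / t"] simp: dil_dil)
    qed
  qed
  define v where "v = (LINT x:V|lborel. (1::real))"
  have "0 \<le> v"
    unfolding v_def set_lebesgue_integral_def by (intro Bochner_Integration.integral_nonneg) auto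
  moreover have "v \<noteq> 0"
    using continuous_set_integral_eq_0[OF \<open>open V\<close> continuous_on_const[of _ "1::real"] set_integrable_const_A[OF _ \<open>V \<subseteq> A\<close>] _ _ \<open>x0 \<in> V\<close>]
      \<open>open V\<close> by (auto simp: v_def)
  ultimately have "0 < v" by simp
  \<comment> \<open>The layer of \<open>V\<close> outside its shrunken copy has volume
    \<open>(1 - t ^ DIM('a)) * v\<close>, lies in the layer of \<open>A\<close> by
    \<open>V_dil\<close>, and carries values of at least \<open>1 - l\<close>.\<close>
  have \<kappa>: "(1 - t ^ DIM('a)) * ((1 - l) ^ m * v) \<le> (LINT x:A - dil P t ` A|lborel. h x ^ m)"
    if t: "0 < t" "t < 1" for t
  proof -
    have sets: "dil P t ` V \<in> sets borel" "V \<in> sets borel" "dil P t ` A \<in> sets borel"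
      using open_dil_image \<open>open V\<close> t open_A by auto
    have sub: "dil P t ` V \<subseteq> V"
      using V_dil t \<open>V \<subseteq> A\<close> by auto
    have "v = (LINT x:dil P t ` V \<union> (V - dil P t ` V)|lborel. 1)"
      using sub unfolding v_def by (simp add: Un_absorb1)
    also have "\<dots> = (LINT x:dil P t ` V|lborel. 1) + (LINT x:V - dil P t ` V|lborel. 1)"
      using sets sub \<open>V \<subseteq> A\<close> by (intro set_integral_Un set_integrable_const_A) auto
    also have "(LINT x:dil P t ` V|lborel. 1) = t ^ DIM('a) * v"
      unfolding v_def using sets t by (intro set_integral_dil_image) auto
    finally have "(1 - t ^ DIM('a)) * v = (LINT x:V - dil P t ` V|lborel. 1)"
      by (simp add: algebra_simps)
    then have "(1 - t ^ DIM('a)) * ((1 - l) ^ m * v) = (LINT x:V - dil P t ` V|lborel. (1 - l) ^ m)"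
      using set_integral_mult_right[of lborel "V - dil P t ` V" "(1 - l) ^ m" "\<lambda>_. 1"]
      by (simp add: mult_ac)
    also have "\<dots> \<le> (LINT x:V - dil P t ` V|lborel. h x ^ m)"
      using sets \<open>V \<subseteq> A\<close> h_V l
      by (intro set_integral_mono set_integrable_const_A set_integrable_subset_A power_mono) auto
    also have "\<dots> \<le> (LINT x:A - dil P t ` A|lborel. h x ^ m)"
    proof -
      have "V - dil P t ` V \<subseteq> A - dil P t ` A"
        using V_dil t \<open>V \<subseteq> A\<close> by auto
      then show ?thesis
        using sets set_integrable_subset_A[of "V - dil P t ` V" m] set_integrable_subset_A[of "A - dil P t ` A" m] h_nonneg \<open>V \<subseteq> A\<close>
        unfolding set_lebesgue_integral_def set_integrable_def
        by (intro integral_mono) (auto simp: indicator_def)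
    qed
    finally show ?thesis .
  qed
  \<comment> \<open>The hypothesis \<open>eq\<close> makes the right side of
    \<open>moment_deficit\<close> zero, although the left side is positive.\<close>
  have "real m * (weighted_excess m (1/2) / (1 - 1/2)) + real DIM('a) * ((1 - l) ^ m * v) \<le> 0"
    using moment_deficit[of m "1/2", OF _ _ _ \<kappa>] assms by simp
  moreover have "0 \<le> real m * (weighted_excess m (1/2) / (1 - 1/2))"
    using weighted_excess_nonneg[of "1/2" m] by simp
  moreover have "0 < real DIM('a) * ((1 - l) ^ m * v)"
    using l \<open>0 < v\<close> by simp
  ultimately show False by linarith
qed

lemma conelike_if_extremal:
  assumes "0 < m" and eq: "(real DIM('a) + real m) * moment m = real m * moment (m - 1)"
  shows "conelike A P h"
  unfolding conelike_def
proof (intro conjI ballI allI impI)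
  show "h (dil P t x) = 1 - t + t * h x" if "x \<in> A" "0 < t" "t < 1" for x t
    using affine_if_extremal[OF assms that] .
  show "h x \<le> 1 - t" if "x \<in> A" "0 < t" "t < 1" "dil P (1 / t) x \<notin> A" for x t
    using vanishing_if_extremal[OF assms \<open>x \<in> A\<close>, of "1 / t"] that by (simp add: field_simps)
qed

text \<open>Without excess, the estimates behind the recursion can be reversed up to errors
  quadratic in \<open>1 - t\<close>: \<open>power_add_upper\<close> replaces
  \<open>power_add_lower\<close>, and the layer is negligible because \<open>h\<close> is at most
  \<open>1 - t\<close> there.\<close>

lemma extremal_if_conelike:
  assumes cone: "conelike A P h" and m: "2 \<le> m"
  shows "(real DIM('a) + real m) * moment m = real m * moment (m - 1)"
proof (rule antisym)
  define a where "a = (LINT x:A|lborel. (1::real))"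
  have a: "a = moment 0"
    by (simp add: a_def moment_def)
  note int = integrable_moment
  let ?S = "\<lambda>t::real. \<Sum>i<DIM('a). t ^ i"
  let ?L = "\<lambda>t. ?S t * moment m"
  \<comment> \<open>The terms with \<open>a\<close> are the errors; after division by
    \<open>1 - t\<close> they still vanish in the limit.\<close>
  let ?R = "\<lambda>t. t ^ DIM('a) * (real m * (moment (m - 1) - moment m + real m * (1 - t) * a)) + (1 - t) * a"
  have "?L t \<le> ?R t" if t: "0 < t" "t < 1" for t
  proof -
    have sets: "dil P t ` A \<in> sets borel"
      using open_dil_image t open_A by auto
    \<comment> \<open>With \<open>m\<close> at least 2 the integrand is already of second order, so
      bounding the volume of the layer by that of \<open>A\<close> suffices.\<close>
    have "(LINT x:A - dil P t ` A|lborel. h x ^ m) \<le> (LINT x:A - dil P t ` A|lborel. (1 - t) ^ 2)"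
    proof (rule set_integral_mono)
      fix x assume x: "x \<in> A - dil P t ` A"
      then have "h x \<le> 1 - t"
        using cone t unfolding conelike_def by (auto simp: mem_dil_image_iff)
      then have "h x ^ m \<le> (1 - t) ^ m"
        using x h_nonneg by (intro power_mono) auto
      also have "\<dots> \<le> (1 - t) ^ 2"
        using m t by (intro power_decreasing) auto
      finally show "h x ^ m \<le> (1 - t) ^ 2" .
    qed (use sets set_integrable_const_A set_integrable_subset_A in auto)
    also have "\<dots> \<le> (LINT x:A|lborel. (1 - t) ^ 2)"
      using sets set_integrable_const_A[of "A - dil P t ` A" "(1 - t)^2"] set_integrable_const_A[of A "(1 - t)^2"]
      unfolding set_lebesgue_integral_def set_integrable_def
      by (intro integral_mono) (auto simp: indicator_def)
    also have "\<dots> = (1 - t) ^ 2 * a"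
      using set_integral_mult_right[of lborel A "(1 - t) ^ 2" "\<lambda>_. 1"] by (simp add: a_def)
    finally have rem: "(LINT x:A - dil P t ` A|lborel. h x ^ m) \<le> (1 - t) ^ 2 * a" .
    let ?g = "\<lambda>x. h x ^ m + real m * ((1 - t) * (h x ^ (m - 1) - h x ^ m + real m * (1 - t) * 1))"
    have "(LINT x:A|lborel. h (dil P t x) ^ m) \<le> (LINT x:A|lborel. ?g x)"
    proof (rule set_integral_mono)
      show "set_integrable lborel A ?g"
        using int set_integrable_const_A[OF sets_A] by (intro set_integral_add set_integral_diff set_integrable_mult_right) auto
      show "set_integrable lborel A (\<lambda>x. h (dil P t x) ^ m)"
        using t h_nonneg h_le_1 dil_mem
        by (intro set_integrable_bounded_continuous[where B = 1] bounded_A continuous_intros)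
           (auto simp: power_le_one)
      fix x assume x: "x \<in> A"
      define b where "b = (1 - t) * (1 - h x)"
      have b: "0 \<le> b" "b \<le> 1 - t" "0 \<le> h x" "h x + b \<le> 1" "0 \<le> 1 - h x" "1 - h x \<le> 1"
      proof -
        show "0 \<le> h x" "0 \<le> 1 - h x" "1 - h x \<le> 1" "0 \<le> b" "b \<le> 1 - t"
          using x t h_nonneg h_le_1 mult_left_le[of "1 - h x" "1 - t"] by (auto simp: b_def)
        have "b \<le> 1 * (1 - h x)"
          unfolding b_def using x t h_le_1 by (intro mult_right_mono) auto
        then show "h x + b \<le> 1" by simp
      qed
      have hd: "h (dil P t x) = h x + b"
        using cone x t by (simp add: conelike_def b_def algebra_simps)
      \<comment> \<open>A second tangent bound returns the factor \<open>(h x + b) ^ (m - 1)\<close>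
        to \<open>h x ^ (m - 1)\<close>, at a cost of order \<open>1 - t\<close>; multiplied by
        \<open>b\<close> it becomes quadratic.\<close>
      have "(h x + b) ^ (m - 1) \<le> h x ^ (m - 1) + real (m - 1) * (h x + b) ^ (m - 1 - 1) * b"
        using b by (intro power_add_upper) auto
      also have "\<dots> \<le> h x ^ (m - 1) + real m * 1 * (1 - t)"
        using b by (intro add_left_mono mult_mono) (auto simp: power_le_one)
      finally have *: "(h x + b) ^ (m - 1) \<le> h x ^ (m - 1) + real m * (1 - t)" by simp
      have "(h x ^ (m - 1) + real m * (1 - t)) * b
          = (1 - t) * (h x ^ (m - 1) - h x ^ m + (real m * (1 - t)) * (1 - h x))"
        using m by (simp add: b_def power_eq_if algebra_simps)
      also have "\<dots> \<le> (1 - t) * (h x ^ (m - 1) - h x ^ m + real m * (1 - t) * 1)"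
        using b t by (intro add_left_mono mult_left_mono) auto
      finally have **: "(h x ^ (m - 1) + real m * (1 - t)) * b \<le> \<dots>" .
      have "(h x + b) ^ m \<le> h x ^ m + real m * (h x + b) ^ (m - 1) * b"
        using b by (intro power_add_upper) auto
      also have "\<dots> \<le> h x ^ m + real m * ((h x ^ (m - 1) + real m * (1 - t)) * b)"
        unfolding mult.assoc using b * by (intro add_left_mono mult_right_mono mult_left_mono) auto
      also have "\<dots> \<le> ?g x"
        using ** by (intro add_left_mono mult_left_mono) auto
      finally show "h (dil P t x) ^ m \<le> ?g x"
        by (simp only: hd)
    qed
    also have "\<dots> = moment m + real m * ((1 - t) * (moment (m - 1) - moment m + real m * (1 - t) * a))"
      unfolding moment_def a_def using set_integral_mult_right[of lborel A "real m" "\<lambda>_. 1"]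
      by (simp add: int set_integrable_const_A[OF sets_A] set_integral_add set_integral_diff)
    finally have "t ^ DIM('a) * (LINT x:A|lborel. h (dil P t x) ^ m) \<le>
        t ^ DIM('a) * (moment m + real m * ((1 - t) * (moment (m - 1) - moment m + real m * (1 - t) * a)))"
      using t by (intro mult_left_mono) auto
    then have "moment m \<le> t ^ DIM('a) * (moment m + real m * ((1 - t) * (moment (m - 1) - moment m + real m * (1 - t) * a)))
        + (1 - t) ^ 2 * a"
      using moment_split[of t m] t rem by linarith
    moreover have "(1 - t) * ?S t * moment m = moment m - t ^ DIM('a) * moment m"
      unfolding one_diff_power_eq[symmetric] by (simp add: algebra_simps)
    ultimately have "(1 - t) * ?L t \<le> (1 - t) * ?R t"
      by (simp add: algebra_simps power2_eq_square)
    then show ?thesis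
      using t by simp
  qed
  then have "eventually (\<lambda>t. ?L t \<le> ?R t) (at_left 1)"
    using eventually_at_left_real[of 0 1] by (auto elim!: eventually_mono)
  moreover have "(?L \<longlongrightarrow> ?L 1) (at_left 1)" "(?R \<longlongrightarrow> ?R 1) (at_left 1)"
    by (intro tendsto_intros)+
  ultimately have "?L 1 \<le> ?R 1"
    by (intro tendsto_le[of "at_left (1::real)" ?R _ ?L]) auto
  then show "(real DIM('a) + real m) * moment m \<le> real m * moment (m - 1)"
    by (simp add: algebra_simps)
  show "real m * moment (m - 1) \<le> (real DIM('a) + real m) * moment m"
    using m by (intro moment_recursion) auto
qed

end

section \<open>Cone functions\<close>

text \<open>The cone function read off from its level sets: \<open>s\<close> is admissible when
  \<open>x\<close> lies in the copy of \<open>closure A\<close> shrunk towards \<open>P\<close> by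
  the ratio \<open>1 - s\<close>. This makes sense for boundary vertices too.\<close>

definition cone_fun :: "'a::euclidean_space set \<Rightarrow> 'a \<Rightarrow> 'a \<Rightarrow> real" where
  "cone_fun A P x = Sup {s\<in>{0..1}. \<exists>y\<in>closure A. x = s *\<^sub>R P + (1 - s) *\<^sub>R y}"

lemma cone_fun_upper:
  assumes "0 \<le> s" "s \<le> 1" "y \<in> closure A"
  shows "s \<le> cone_fun A P (s *\<^sub>R P + (1 - s) *\<^sub>R y)"
  unfolding cone_fun_def
proof (rule cSup_upper)
  show "s \<in> {s'\<in>{0..1}. \<exists>y'\<in>closure A. s *\<^sub>R P + (1 - s) *\<^sub>R y = s' *\<^sub>R P + (1 - s') *\<^sub>R y'}"
    using assms by (intro CollectI conjI bexI[where x = y] refl) simp_all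
  show "bdd_above {s'\<in>{0..1}. \<exists>y'\<in>closure A. s *\<^sub>R P + (1 - s) *\<^sub>R y = s' *\<^sub>R P + (1 - s') *\<^sub>R y'}"
    by (rule bdd_above_mono[OF bdd_above_Icc[of 0 1]]) blast
qed

text \<open>The admissible \<open>s\<close> form the projection of a compact set of pairs
  \<open>(s, y)\<close>, so the supremum is a maximum.\<close>

lemma cone_fun_attained:
  assumes "bounded A" "x \<in> closure A"
  obtains y where "y \<in> closure A" "x = cone_fun A P x *\<^sub>R P + (1 - cone_fun A P x) *\<^sub>R y"
    "0 \<le> cone_fun A P x" "cone_fun A P x \<le> 1"
proof -
  let ?S = "{s\<in>{0..1}. \<exists>y\<in>closure A. x = s *\<^sub>R P + (1 - s) *\<^sub>R y}"
  let ?Q = "{p. x = fst p *\<^sub>R P + (1 - fst p) *\<^sub>R snd p}"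
  have "?S = fst ` (({0..1} \<times> closure A) \<inter> ?Q)"
    by (intro set_eqI) (simp add: image_iff Bex_def, blast)
  moreover have "compact (({0..1::real} \<times> closure A) \<inter> ?Q)"
    using assms(1)
    by (intro compact_Int_closed compact_Times closed_Collect_eq continuous_intros) auto
  then have "compact (fst ` (({0..1::real} \<times> closure A) \<inter> ?Q))"
    by (intro compact_continuous_image continuous_intros)
  ultimately have "closed ?S"
    by (simp only: compact_imp_closed)
  moreover have "0 \<in> ?S"
    using assms(2) by (intro CollectI conjI bexI[where x = x]) simp_all
  moreover have "bdd_above ?S"
    by (rule bdd_above_mono[OF bdd_above_Icc[of 0 1]]) blast
  moreover have "?S \<noteq> {}"
    using \<open>0 \<in> ?S\<close> by blast
  ultimately have "Sup ?S \<in> ?S"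
    by (intro closed_contains_Sup)
  then have "cone_fun A P x \<in> ?S"
    unfolding cone_fun_def .
  then show thesis
    using that unfolding mem_Collect_eq atLeastAtMost_iff by blast
qed

lemma cone_fun_bounds:
  assumes "bounded A" "x \<in> closure A"
  shows "0 \<le> cone_fun A P x" "cone_fun A P x \<le> 1"
  using cone_fun_attained[OF assms, of P] by blast+

lemma cone_fun_vertex:
  assumes "bounded A" "P \<in> closure A"
  shows "cone_fun A P P = 1"
proof (rule antisym)
  show "cone_fun A P P \<le> 1"
    by (rule cone_fun_bounds[OF assms])
  have "1 \<le> cone_fun A P (1 *\<^sub>R P + (1 - 1) *\<^sub>R P)"
    using assms(2) by (intro cone_fun_upper) auto
  then show "1 \<le> cone_fun A P P"
    by simp
qed

text \<open>Averaging the representations of two points averages their shares of \<open>P\<close>,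
  and convexity merges the two base points into one.\<close>

lemma concave_cone_fun:
  assumes "bounded A" "convex A" "P \<in> closure A"
  shows "concave_on (closure A) (cone_fun A P)"
  unfolding concave_on_iff
proof (intro conjI ballI allI impI)
  show "convex (closure A)"
    using assms(2) by (rule convex_closure)
  fix x x' and u v :: real
  assume xs: "x \<in> closure A" "x' \<in> closure A" and uv: "0 \<le> u" "0 \<le> v" "u + v = 1"
  obtain y where y: "y \<in> closure A" "x = cone_fun A P x *\<^sub>R P + (1 - cone_fun A P x) *\<^sub>R y"
    by (rule cone_fun_attained[OF assms(1) xs(1)])
  obtain y' where y': "y' \<in> closure A" "x' = cone_fun A P x' *\<^sub>R P + (1 - cone_fun A P x') *\<^sub>R y'"
    by (rule cone_fun_attained[OF assms(1) xs(2)])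
  define a b where "a = cone_fun A P x" and "b = cone_fun A P x'"
  have ab: "0 \<le> a" "a \<le> 1" "0 \<le> b" "b \<le> 1"
    using cone_fun_bounds[OF assms(1)] xs by (auto simp: a_def b_def)
  \<comment> \<open>The total weights falling on \<open>P\<close> and on the base points
    \<open>y\<close>, \<open>y'\<close>.\<close>
  define s w where "s = u * a + v * b" and "w = u * (1 - a) + v * (1 - b)"
  have w: "w = 1 - s" "0 \<le> w" "0 \<le> s"
  proof -
    have "w + s = u + v"
      by (simp add: s_def w_def algebra_simps)
    then show "w = 1 - s" using uv by simp
    show "0 \<le> w" "0 \<le> s"
      using ab uv by (simp_all add: s_def w_def)
  qed
  have "u *\<^sub>R x + v *\<^sub>R x' = u *\<^sub>R (a *\<^sub>R P + (1 - a) *\<^sub>R y) + v *\<^sub>R (b *\<^sub>R P + (1 - b) *\<^sub>R y')"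
    using y(2) y'(2) by (simp add: a_def b_def)
  then have eq: "u *\<^sub>R x + v *\<^sub>R x' = s *\<^sub>R P + ((u * (1 - a)) *\<^sub>R y + (v * (1 - b)) *\<^sub>R y')"
    by (simp add: s_def algebra_simps)
  obtain z where z: "z \<in> closure A" "u *\<^sub>R x + v *\<^sub>R x' = s *\<^sub>R P + (1 - s) *\<^sub>R z"
  proof (cases "w = 0")
    \<comment> \<open>Then \<open>s = 1\<close>, and any base point in the closure will do.\<close>
    case True
    then have 0: "u * (1 - a) = 0" "v * (1 - b) = 0"
      using ab uv by (auto simp: w_def add_nonneg_eq_0_iff)
    show thesis
    proof (rule that[OF assms(3)])
      show "u *\<^sub>R x + v *\<^sub>R x' = s *\<^sub>R P + (1 - s) *\<^sub>R P"
        unfolding eq 0 using w(1) True by simp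
    qed
  next
    case False
    define z where "z = (u * (1 - a) / w) *\<^sub>R y + (v * (1 - b) / w) *\<^sub>R y'"
    have "z \<in> closure A"
      unfolding z_def using y(1) y'(1) ab uv w False
      by (intro convexD[OF convex_closure[OF assms(2)]]) (auto simp: w_def add_divide_distrib[symmetric])
    moreover have "(1 - s) *\<^sub>R z = (u * (1 - a)) *\<^sub>R y + (v * (1 - b)) *\<^sub>R y'"
      using False w(1)[symmetric] by (simp add: z_def scaleR_add_right)
    ultimately show thesis
      using that eq by simp
  qed
  have "s \<le> cone_fun A P (u *\<^sub>R x + v *\<^sub>R x')"
    unfolding z(2) using w z(1) by (intro cone_fun_upper) auto
  then show "u * cone_fun A P x + v * cone_fun A P x' \<le> cone_fun A P (u *\<^sub>R x + v *\<^sub>R x')"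
    by (simp add: s_def a_def b_def)
qed

text \<open>A positive share of an interior point \<open>P\<close> moves every point of the closure
  into the interior.\<close>

lemma cone_fun_eq_0_on_frontier:
  assumes "bounded A" "convex A" "P \<in> interior A" "x \<in> frontier A"
  shows "cone_fun A P x = 0"
proof (rule ccontr)
  assume "cone_fun A P x \<noteq> 0"
  have x: "x \<in> closure A" "x \<notin> interior A"
    using assms(4) by (auto simp: frontier_def)
  obtain y where y: "y \<in> closure A" "x = cone_fun A P x *\<^sub>R P + (1 - cone_fun A P x) *\<^sub>R y"
    "0 \<le> cone_fun A P x" "cone_fun A P x \<le> 1"
    by (rule cone_fun_attained[OF assms(1) x(1)])
  have "y - cone_fun A P x *\<^sub>R (y - P) \<in> interior A"
    using y(1,3,4) \<open>cone_fun A P x \<noteq> 0\<close> assms by (intro mem_interior_closure_convex_shrink) auto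
  moreover have "y - cone_fun A P x *\<^sub>R (y - P) = x"
    by (subst (2) y(2)) (simp add: algebra_simps)
  ultimately show False
    using x(2) by simp
qed

text \<open>Concavity of \<open>k\<close> applied to an optimal representation of \<open>x\<close>,
  with \<open>k P = 1\<close> and \<open>k y\<close> nonnegative at the base point.\<close>

lemma cone_fun_least:
  assumes "bounded A" "P \<in> closure A" "x \<in> closure A"
    and "concave_on (closure A) k" "\<And>y. y \<in> closure A \<Longrightarrow> 0 \<le> k y" "k P = 1"
  shows "cone_fun A P x \<le> k x"
proof -
  obtain y where y: "y \<in> closure A" "x = cone_fun A P x *\<^sub>R P + (1 - cone_fun A P x) *\<^sub>R y"
    "0 \<le> cone_fun A P x" "cone_fun A P x \<le> 1"
    by (rule cone_fun_attained[OF assms(1,3)])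
  have "cone_fun A P x \<le> cone_fun A P x * k P + (1 - cone_fun A P x) * k y"
    using y(1,4) assms(5,6) by simp
  also have "\<dots> \<le> k (cone_fun A P x *\<^sub>R P + (1 - cone_fun A P x) *\<^sub>R y)"
    using concave_onD[OF assms(4), of "1 - cone_fun A P x" P y] y(1,3,4) assms(2) by simp
  finally show ?thesis
    by (simp only: y(2)[symmetric])
qed

text \<open>The dictionary between the combinations in \<open>cone_fun\<close> and the homotheties
  in \<open>conelike\<close>.\<close>

lemma dil_cone_combination:
  assumes "s < 1"
  shows "x = s *\<^sub>R P + (1 - s) *\<^sub>R y \<longleftrightarrow> y = dil P (1 / (1 - s)) x"
proof -
  have "x = s *\<^sub>R P + (1 - s) *\<^sub>R y \<longleftrightarrow> x = dil P (1 - s) y"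
    by (simp add: dil_def algebra_simps)
  then show ?thesis
    using assms by (auto simp: dil_dil)
qed

text \<open>A point and its homothetic image admit the same base points as long as the share of
  \<open>P\<close> permits it, which gives affinity on rays.\<close>

lemma conelike_cone_fun:
  assumes "open A" "bounded A" "convex A" "P \<in> closure A"
  shows "conelike A P (cone_fun A P)"
  unfolding conelike_def
proof (intro conjI ballI allI impI)
  fix x and t :: real
  assume x: "x \<in> A" and t: "0 < t" "t < 1"
  let ?K = "cone_fun A P"
  have xc: "x \<in> closure A" using x closure_subset by auto
  have dc: "dil P t x \<in> closure A"
    using dil_mem_open_convex[OF assms(1,3,4) x t(1)] t closure_subset by auto
  obtain y where y: "y \<in> closure A" "x = ?K x *\<^sub>R P + (1 - ?K x) *\<^sub>R y" "0 \<le> ?K x" "?K x \<le> 1"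
    by (rule cone_fun_attained[OF assms(2) xc])
  show "?K (dil P t x) = 1 - t + t * ?K x"
  proof (rule antisym)
    have "dil P t (?K x *\<^sub>R P + (1 - ?K x) *\<^sub>R y)
        = (1 - t + t * ?K x) *\<^sub>R P + (1 - (1 - t + t * ?K x)) *\<^sub>R y"
      by (simp add: dil_def algebra_simps)
    moreover have "0 \<le> 1 - t + t * ?K x" "1 - t + t * ?K x \<le> 1"
      using t y(3,4) mult_left_le[of "?K x" t] by auto
    ultimately show "1 - t + t * ?K x \<le> ?K (dil P t x)"
      using cone_fun_upper[OF _ _ y(1)] y(2) by metis
    define s where "s = ?K (dil P t x)"
    show "?K (dil P t x) \<le> 1 - t + t * ?K x"
    proof (cases "s \<le> 1 - t")
      case True
      then show ?thesis
        using y(3,4) t mult_nonneg_nonneg[of t "?K x"] unfolding s_def by linarith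
    next
      case False
      obtain z where z: "z \<in> closure A" "dil P t x = s *\<^sub>R P + (1 - s) *\<^sub>R z" "0 \<le> s" "s \<le> 1"
        unfolding s_def by (rule cone_fun_attained[OF assms(2) dc])
      \<comment> \<open>The share of \<open>P\<close> after pulling the representation of
        \<open>dil P t x\<close> back to \<open>x\<close>; it solves
        \<open>1 - s = t * (1 - q)\<close>.\<close>
      define q where "q = (s - (1 - t)) / t"
      have q: "0 \<le> q" "q \<le> 1" "(1 - s) = t * (1 - q)" "s = 1 - t * (1 - q)"
        using False t z by (auto simp: q_def field_simps)
      have "x = dil P (1 / t) (s *\<^sub>R P + (1 - s) *\<^sub>R z)"
        using t by (simp add: z(2)[symmetric] dil_dil)
      also have "s *\<^sub>R P + (1 - s) *\<^sub>R z = dil P (t * (1 - q)) z"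
        unfolding q(4) by (simp add: dil_def algebra_simps)
      also have "dil P (1 / t) \<dots> = q *\<^sub>R P + (1 - q) *\<^sub>R z"
        using t by (simp add: dil_dil) (simp add: dil_def algebra_simps)
      finally have "q \<le> ?K x"
        using cone_fun_upper[OF q(1,2) z(1)] by simp
      then have "t * q \<le> t * ?K x"
        using t by simp
      then show ?thesis
        using t by (simp add: q_def s_def)
    qed
  qed
next
  fix x and t :: real
  assume x: "x \<in> A" and t: "0 < t" "t < 1" and out: "dil P (1 / t) x \<notin> A"
  let ?K = "cone_fun A P"
  have xc: "x \<in> closure A" using x closure_subset by auto
  obtain y where y: "y \<in> closure A" "x = ?K x *\<^sub>R P + (1 - ?K x) *\<^sub>R y" "0 \<le> ?K x" "?K x \<le> 1"
    by (rule cone_fun_attained[OF assms(2) xc])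
  show "?K x \<le> 1 - t"
  proof (rule ccontr)
    assume less: "\<not> ?K x \<le> 1 - t"
    show False
    proof (cases "?K x = 1")
      case True
      then have "x = P" by (subst y(2)) simp
      then show False using out x by (simp add: dil_def)
    next
      case False
      then have "?K x < 1" using y(4) by simp
      \<comment> \<open>This is the base point of \<open>x\<close>. If \<open>?K x\<close> exceeded
        \<open>1 - t\<close>, then \<open>dil P (1 / t) x\<close> would come strictly before it on
        the ray and hence lie in \<open>A\<close>.\<close>
      then have "dil P (1 / (1 - ?K x)) x \<in> closure A"
        using iffD1[OF dil_cone_combination y(2)] y(1) by simp
      then have "dil P (1 / t) x \<in> A"
        using less t \<open>?K x < 1\<close>
        by (intro dil_between[OF assms(1,3) x, of P "1 / (1 - ?K x)"]) (auto simp: frac_less2)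
      with out show False ..
    qed
  qed
qed

text \<open>For \<open>s\<close> strictly below either value, the second clause of
  \<open>conelike\<close> puts \<open>dil P (1 / (1 - s)) x\<close> into \<open>A\<close>. That
  point witnesses \<open>s\<close> for \<open>cone_fun\<close>, and affinity with \<open>h\<close>
  nonnegative there gives \<open>s \<le> h x\<close>. Working below the value avoids the end of the
  ray.\<close>

lemma conelike_unique:
  assumes "open A" "convex A" "bounded A" "P \<in> closure A"
    and cone: "conelike A P h" and rng: "\<And>x. x \<in> A \<Longrightarrow> 0 \<le> h x \<and> h x \<le> 1" and "x \<in> A"
  shows "h x = cone_fun A P x"
proof (rule antisym)
  let ?K = "cone_fun A P"
  have xc: "x \<in> closure A" using \<open>x \<in> A\<close> closure_subset by auto
  note K = cone_fun_bounds[OF assms(3) xc, of P]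
  show "h x \<le> ?K x"
  proof (rule dense_le)
    fix s assume "s < h x"
    show "s \<le> ?K x"
    proof (cases "0 < s")
      case True
      have "s < 1" using \<open>s < h x\<close> rng[OF \<open>x \<in> A\<close>] by simp
      have "dil P (1 / (1 - s)) x \<in> A"
      proof (rule ccontr)
        assume "dil P (1 / (1 - s)) x \<notin> A"
        then have "h x \<le> 1 - (1 - s)"
          using cone True \<open>s < 1\<close> \<open>x \<in> A\<close> unfolding conelike_def
          by (metis diff_gt_0_iff_gt diff_less_eq less_add_same_cancel1)
        then show False using \<open>s < h x\<close> by simp
      qed
      then show ?thesis
        using cone_fun_upper[of s "dil P (1 / (1 - s)) x" A P] True \<open>s < 1\<close> closure_subset
          dil_cone_combination[of s x P "dil P (1 / (1 - s)) x"] by auto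
    qed (use K in auto)
  qed
  show "?K x \<le> h x"
  proof (rule dense_le)
    fix s assume "s < ?K x"
    show "s \<le> h x"
    proof (cases "0 < s")
      case True
      have "s < 1" using \<open>s < ?K x\<close> K by simp
      have "dil P (1 / (1 - s)) x \<in> A"
      proof (rule ccontr)
        assume "dil P (1 / (1 - s)) x \<notin> A"
        then have "?K x \<le> 1 - (1 - s)"
          using conelike_cone_fun[OF assms(1,3,2,4)] True \<open>s < 1\<close> \<open>x \<in> A\<close> unfolding conelike_def
          by (metis diff_gt_0_iff_gt diff_less_eq less_add_same_cancel1)
        then show False using \<open>s < ?K x\<close> by simp
      qed
      then have "h (dil P (1 - s) (dil P (1 / (1 - s)) x)) = 1 - (1 - s) + (1 - s) * h (dil P (1 / (1 - s)) x)"
        and "0 \<le> h (dil P (1 / (1 - s)) x)"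
        using cone True \<open>s < 1\<close> rng unfolding conelike_def by auto
      then show ?thesis
        using \<open>s < 1\<close> by (simp add: dil_dil)
    qed (use rng[OF \<open>x \<in> A\<close>] in auto)
  qed
qed

section \<open>The cubic ratio\<close>

lemma (in peaked_concave) moment_ratio_ge:
  "6 / ((real DIM('a) + 2) * (real DIM('a) + 3)) \<le> moment 3 / moment 1"
proof -
  let ?n = "real DIM('a)"
  have "2 * moment 1 \<le> (?n + 2) * moment 2"
    using moment_recursion[of 2] by simp
  then have "6 * moment 1 \<le> 3 * ((?n + 2) * moment 2)"
    by linarith
  also have "\<dots> = (?n + 2) * (3 * moment 2)"
    by simp
  also have "\<dots> \<le> (?n + 2) * ((?n + 3) * moment 3)"
    using moment_recursion[of 3] by (intro mult_left_mono) auto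
  finally show ?thesis
    using moment_pos[of 1] by (simp add: divide_simps mult_ac)
qed

text \<open>Equality in the combined bound forces equality in the recursion for
  \<open>m = 2\<close>, hence a cone; a cone in turn gives equality for both \<open>m = 2\<close>
  and \<open>m = 3\<close>.\<close>

lemma (in peaked_concave) moment_ratio_eq_iff:
  "moment 3 / moment 1 = 6 / ((real DIM('a) + 2) * (real DIM('a) + 3)) \<longleftrightarrow> conelike A P h"
proof
  let ?n = "real DIM('a)"
  have pos: "0 < ?n + 2" "0 < ?n + 3" by auto
  assume "moment 3 / moment 1 = 6 / ((?n + 2) * (?n + 3))"
  then have "(?n + 2) * ((?n + 3) * moment 3) = 6 * moment 1"
    using moment_pos[of 1] pos by (simp add: divide_simps mult_ac)
  moreover have "(?n + 2) * (3 * moment 2) \<le> (?n + 2) * ((?n + 3) * moment 3)"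
    using moment_recursion[of 3] by (intro mult_left_mono) auto
  moreover have "2 * moment 1 \<le> (?n + 2) * moment 2"
    using moment_recursion[of 2] by simp
  ultimately have "(?n + 2) * moment 2 = 2 * moment 1"
    by linarith
  then show "conelike A P h"
    using conelike_if_extremal[of 2] by simp
next
  let ?n = "real DIM('a)"
  have pos: "0 < ?n + 2" "0 < ?n + 3" by auto
  assume "conelike A P h"
  then have eqs: "(?n + 2) * moment 2 = 2 * moment 1" "(?n + 3) * moment 3 = 3 * moment 2"
    using extremal_if_conelike[of 2] extremal_if_conelike[of 3] by auto
  have "(?n + 2) * ((?n + 3) * moment 3) = 3 * ((?n + 2) * moment 2)"
    unfolding eqs(2) by simp
  then have "(?n + 2) * ((?n + 3) * moment 3) = 6 * moment 1"
    unfolding eqs(1) by simp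
  then show "moment 3 / moment 1 = 6 / ((?n + 2) * (?n + 3))"
    using moment_pos[of 1] pos by (simp add: divide_simps mult_ac)
qed

section \<open>Lebesgue integral, essential supremum and choice of a vertex\<close>

lemma integral_lebesgue_on_open:
  fixes f :: "'a::euclidean_space \<Rightarrow> real"
  assumes "open A" "continuous_on A f"
  shows "(LINT x|lebesgue_on A. f x) = (LINT x:A|lborel. f x)"
proof -
  have "(\<lambda>x. indicator A x *\<^sub>R f x) \<in> borel_measurable lborel"
    using borel_measurable_continuous_on_indicator[of A f] assms by simp
  then show ?thesis
    using assms(1)
    by (simp add: integral_restrict_space integral_completion set_lebesgue_integral_def)
qed

lemma (in peaked_concave) moment_eq_lebesgue: "(LINT x|lebesgue_on A. h x ^ m) = moment m"
  unfolding moment_def by (intro integral_lebesgue_on_open open_A continuous_intros)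

lemma cubic_ratio_eq_moments:
  assumes "peaked_concave A P h"
  shows "cubic_ratio A h = peaked_concave.moment A h 3 / peaked_concave.moment A h 1"
  using peaked_concave.moment_eq_lebesgue[OF assms, of 3] peaked_concave.moment_eq_lebesgue[OF assms, of 1]
  by (simp add: cubic_ratio_def)

lemma open_eq_empty_if_AE_lebesgue_on:
  fixes U A :: "'a::euclidean_space set"
  assumes "open U" "U \<subseteq> A" "open A" "AE x in lebesgue_on A. x \<notin> U"
  shows "U = {}"
proof (rule open_eq_empty_if_AE_notin[OF \<open>open U\<close>])
  have "AE x in lebesgue. x \<in> A \<longrightarrow> x \<notin> U"
    using assms by (simp add: AE_restrict_space_iff)
  then have "AE x in lborel. x \<in> A \<longrightarrow> x \<notin> U"
    by (simp add: AE_completion_iff)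
  then show "AE x in lborel. x \<notin> U"
    by eventually_elim (use assms(2) in auto)
qed

text \<open>For a continuous function on an open set, bounds almost everywhere hold everywhere, so
  the essential supremum is the supremum.\<close>

lemma Linfty_norm_eq_1_iff:
  fixes A :: "(real^'n) set"
  assumes "open A" "continuous_on A h" "\<And>x. x \<in> A \<Longrightarrow> 0 \<le> h x"
  shows "Linfty_norm A h = 1 \<longleftrightarrow> (\<forall>x\<in>A. h x \<le> 1) \<and> (\<forall>c<1. \<exists>x\<in>A. c < h x)"
proof -
  have meas: "(\<lambda>x. ereal \<bar>h x\<bar>) \<in> borel_measurable (lebesgue_on A)"
    using assms(1,2) continuous_imp_measurable_on_sets_lebesgue[of A h] by auto
  have le_iff: "Linfty_norm A h \<le> ereal c \<longleftrightarrow> (\<forall>x\<in>A. h x \<le> c)" for c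
  proof
    assume le: "Linfty_norm A h \<le> ereal c"
    have "AE x in lebesgue_on A. ereal \<bar>h x\<bar> \<le> Linfty_norm A h"
      unfolding Linfty_norm_def by (rule esssup_AE)
    then have "AE x in lebesgue_on A. x \<notin> {x\<in>A. c < h x}"
    proof eventually_elim
      case (elim x)
      then have "ereal \<bar>h x\<bar> \<le> ereal c" using le by (rule order_trans)
      then show ?case by auto
    qed
    moreover have "open {x\<in>A. c < h x}"
      using continuous_open_preimage[OF assms(2,1) open_greaterThan[of c]]
      by (simp add: vimage_def Int_def conj_commute)
    ultimately have "{x\<in>A. c < h x} = {}"
      using assms(1) by (intro open_eq_empty_if_AE_lebesgue_on[of _ A]) auto
    then show "\<forall>x\<in>A. h x \<le> c" by force
  next
    assume "\<forall>x\<in>A. h x \<le> c"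
    then show "Linfty_norm A h \<le> ereal c"
      unfolding Linfty_norm_def using assms(3)
      by (intro esssup_I meas AE_I2) auto
  qed
  have "Linfty_norm A h = 1 \<longleftrightarrow> Linfty_norm A h \<le> ereal 1 \<and> (\<forall>c<1. \<not> Linfty_norm A h \<le> ereal c)"
  proof (intro iffI conjI allI impI)
    assume R: "Linfty_norm A h \<le> ereal 1 \<and> (\<forall>c<1. \<not> Linfty_norm A h \<le> ereal c)"
    have "1 \<le> Linfty_norm A h"
    proof (rule ccontr)
      assume "\<not> 1 \<le> Linfty_norm A h"
      then obtain c where "Linfty_norm A h < ereal c" "ereal c < ereal 1"
        using ereal_dense2[of "Linfty_norm A h" "ereal 1"] by (auto simp: one_ereal_def not_le)
      then show False using R by auto
    qed
    then show "Linfty_norm A h = 1" using R by (auto simp: one_ereal_def)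
  qed (auto simp: one_ereal_def)
  then show ?thesis
    unfolding le_iff by (auto simp: not_le)
qed

text \<open>If the value 1 is attained in \<open>A\<close>, the vertex can be taken in
  \<open>A\<close>; this leads to genuine cone functions in the equality case.\<close>

lemma peaked_concave_at_maximum:
  fixes A :: "'a::euclidean_space set"
  assumes "open A" "bounded A" "concave_on A h" "\<And>x. x \<in> A \<Longrightarrow> 0 \<le> h x \<and> h x \<le> 1"
    and "P \<in> A" "h P = 1"
  shows "peaked_concave A P h"
proof
  fix x t assume "x \<in> A" "0 < t" "t < (1::real)"
  then have "(1 - t) * h P + t * h x \<le> h ((1 - t) *\<^sub>R P + t *\<^sub>R x)"
    using assms by (intro concave_onD) auto
  then show "1 - t + t * h x \<le> h (dil P t x)"
    using assms by (simp add: dil_def algebra_simps)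
qed (use assms closure_subset in auto)

text \<open>A limit of points at which \<open>h\<close> tends to its supremum serves as vertex.\<close>

lemma peaked_concave_exists:
  fixes A :: "'a::euclidean_space set"
  assumes "open A" "bounded A" "A \<noteq> {}" "concave_on A h" "\<And>x. x \<in> A \<Longrightarrow> 0 \<le> h x \<and> h x \<le> 1"
    and sup: "\<And>c. c < 1 \<Longrightarrow> \<exists>x\<in>A. c < h x"
  obtains P where "peaked_concave A P h"
proof -
  note conv = concave_on_imp_convex[OF assms(4)]
  note cont = concave_on_continuous_open[OF assms(1,4)]
  have "\<exists>x\<in>A. 1 - 1 / (real n + 1) < h x" for n :: nat
    by (rule sup) simp
  then obtain p where p: "\<And>n. p n \<in> A" "\<And>n. 1 - 1 / (real n + 1) < h (p n)"
    by metis
  have "compact (closure A)"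
    using assms(2) by simp
  moreover have "\<forall>n. p n \<in> closure A"
    using p(1) closure_subset by blast
  ultimately obtain P and r :: "nat \<Rightarrow> nat"
    where P: "P \<in> closure A" "strict_mono r" "(p \<circ> r) \<longlonglongrightarrow> P"
    unfolding compact_def by metis
  have hp: "(\<lambda>n. h (p (r n))) \<longlonglongrightarrow> 1"
  proof (rule tendsto_sandwich[where h = "\<lambda>_. 1"])
    have "(\<lambda>n. 1 - 1 / (real n + 1)) \<longlonglongrightarrow> 1"
      by real_asymp
    then show "(\<lambda>n. 1 - 1 / (real (r n) + 1)) \<longlonglongrightarrow> 1"
      using LIMSEQ_subseq_LIMSEQ[OF _ P(2)] by (force simp: o_def)
  qed (use p assms(5) in \<open>auto intro!: always_eventually intro: less_imp_le\<close>)
  have "peaked_concave A P h"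
  proof
    fix x t assume x: "x \<in> A" and t: "0 < t" "t < (1::real)"
    \<comment> \<open>Even for \<open>P\<close> on the boundary this point is in \<open>A\<close>,
      so \<open>h\<close> is continuous there and concavity at the points \<open>p (r n)\<close>
      passes to the limit.\<close>
    have "dil P t x \<in> A"
      using dil_mem_open_convex[OF assms(1) conv P(1) x] t by auto
    then have "isCont h (dil P t x)"
      using cont assms(1) by (simp add: continuous_on_eq_continuous_at)
    moreover have "(\<lambda>n. dil (p (r n)) t x) \<longlonglongrightarrow> dil P t x"
      using P(3) unfolding dil_def o_def by (intro tendsto_intros)
    ultimately have "(\<lambda>n. h (dil (p (r n)) t x)) \<longlonglongrightarrow> h (dil P t x)"
      by (rule isCont_tendsto_compose)
    moreover have "(\<lambda>n. (1 - t) * h (p (r n)) + t * h x) \<longlonglongrightarrow> (1 - t) * 1 + t * h x"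
      by (intro tendsto_intros hp)
    moreover have "(1 - t) * h (p (r n)) + t * h x \<le> h (dil (p (r n)) t x)" for n
      using concave_onD[OF assms(4), of t "p (r n)" x] p(1) x t
      by (simp add: dil_def algebra_simps)
    ultimately have "(1 - t) * 1 + t * h x \<le> h (dil P t x)"
      by (intro LIMSEQ_le) auto
    then show "1 - t + t * h x \<le> h (dil P t x)" by simp
  qed (use assms P in auto)
  then show thesis by (rule that)
qed

section \<open>Cone functions as smallest concave functions\<close>

text \<open>Two smallest members of a class agree on \<open>S\<close>, so the unknown
  \<open>g\<close> may be replaced by an explicit one.\<close>

lemma agrees_with_smallest_on_iff:
  assumes "smallest_on S C g0" "A \<subseteq> S"
  shows "(\<exists>g. smallest_on S C g \<and> (\<forall>x\<in>A. h x = g x)) \<longleftrightarrow> (\<forall>x\<in>A. h x = g0 x)"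
proof
  assume "\<exists>g. smallest_on S C g \<and> (\<forall>x\<in>A. h x = g x)"
  then obtain g where g: "smallest_on S C g" "\<forall>x\<in>A. h x = g x"
    by blast
  have "g x = g0 x" if "x \<in> S" for x
    using g(1) assms(1) that unfolding smallest_on_def by (intro antisym) blast+
  then show "\<forall>x\<in>A. h x = g0 x"
    using g(2) assms(2) by (metis subsetD)
qed (use assms(1) in blast)

lemma smallest_on_cone_fun:
  assumes "bounded A" "convex A" "P \<in> closure A"
  shows "smallest_on (closure A) (concave_peak A P) (cone_fun A P)"
  unfolding smallest_on_def concave_peak_def
  using cone_fun_bounds[OF assms(1)] cone_fun_vertex[OF assms(1,3)] concave_cone_fun[OF assms]
    cone_fun_least[OF assms(1,3)] by blast

text \<open>The smallest function of the class without boundary condition already vanishes on the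
  frontier, so it is also smallest in the restricted class.\<close>

lemma smallest_on_cone_fun_interior:
  assumes "bounded A" "convex A" "P \<in> interior A"
  shows "smallest_on (closure A) (\<lambda>k. concave_peak A P k \<and> (\<forall>x\<in>frontier A. k x = 0)) (cone_fun A P)"
proof -
  have "P \<in> closure A"
    using assms(3) interior_subset closure_subset by blast
  from smallest_on_cone_fun[OF assms(1,2) this] cone_fun_eq_0_on_frontier[OF assms]
  show ?thesis
    by (auto simp: smallest_on_def)
qed

lemma is_cone_function_iff:
  assumes "open A" "bounded A" "convex A"
  shows "is_cone_function A h \<longleftrightarrow> (\<exists>P\<in>A. \<forall>x\<in>A. h x = cone_fun A P x)"
  unfolding is_cone_function_def interior_open[OF assms(1)]
  using agrees_with_smallest_on_iff[OF smallest_on_cone_fun_interior[OF assms(2,3)] closure_subset]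
    interior_open[OF assms(1)] by (intro bex_cong) simp_all

lemma is_boundary_cone_function_iff:
  assumes "bounded A" "convex A"
  shows "is_boundary_cone_function A h \<longleftrightarrow> (\<exists>P\<in>frontier A. \<forall>x\<in>A. h x = cone_fun A P x)"
  unfolding is_boundary_cone_function_def
  using agrees_with_smallest_on_iff[OF smallest_on_cone_fun[OF assms] closure_subset]
  by (intro bex_cong) (simp_all add: frontier_def)

lemma conelike_iff_cone_fun:
  assumes "open A" "bounded A" "convex A" "P \<in> closure A" "\<And>x. x \<in> A \<Longrightarrow> 0 \<le> h x \<and> h x \<le> 1"
  shows "conelike A P h \<longleftrightarrow> (\<forall>x\<in>A. h x = cone_fun A P x)"
proof
  show "\<forall>x\<in>A. h x = cone_fun A P x" if "conelike A P h"
    using conelike_unique[OF assms(1,3,2,4) that assms(5)] by blast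
  show "conelike A P h" if "\<forall>x\<in>A. h x = cone_fun A P x"
    using conelike_cone_fun[OF assms(1-4)] that dil_mem_open_convex[OF assms(1,3,4)]
    by (auto simp: conelike_def)
qed

lemma cubic_ratio_eq_iff_cone_fun:
  fixes A :: "(real^'n) set"
  assumes "peaked_concave A P h"
  shows "cubic_ratio A h = 6 / ((real CARD('n) + 2) * (real CARD('n) + 3))
    \<longleftrightarrow> (\<forall>x\<in>A. h x = cone_fun A P x)"
proof -
  interpret peaked_concave A P h by fact
  have "conelike A P h \<longleftrightarrow> (\<forall>x\<in>A. h x = cone_fun A P x)"
    using open_A bounded_A convex_A P_closure h_nonneg h_le_1 by (intro conelike_iff_cone_fun) auto
  then show ?thesis
    using moment_ratio_eq_iff cubic_ratio_eq_moments[OF assms] by simp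
qed

text \<open>Lets the vertex of a given cone serve as the peak, so that the equality criterion
  applies at that very point.\<close>

lemma peaked_concave_cone_fun:
  assumes "open A" "bounded A" "A \<noteq> {}" "concave_on A h" "P \<in> closure A"
    and rng: "\<And>x. x \<in> A \<Longrightarrow> 0 \<le> h x \<and> h x \<le> 1" and eq: "\<forall>x\<in>A. h x = cone_fun A P x"
  shows "peaked_concave A P h"
proof
  have "conelike A P h"
    using conelike_iff_cone_fun[of A P h] assms(1,2,5) concave_on_imp_convex[OF assms(4)] rng eq by blast
  then show "1 - t + t * h x \<le> h (dil P t x)" if "x \<in> A" "0 < t" "t < 1" for x t
    using that by (simp add: conelike_def)
qed (use assms in auto)

text \<open>Pointwise \<open>h x ^ 3 \<le> h x\<close>. Equality of the integrals makes the
  continuous difference vanish, and positivity of \<open>h\<close> leaves only the value 1.\<close>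

lemma cubic_ratio_le_1:
  fixes A :: "(real^'n) set"
  assumes "peaked_concave A P h"
  shows "cubic_ratio A h \<le> 1" "cubic_ratio A h = 1 \<longleftrightarrow> (\<forall>x\<in>A. h x = 1)"
proof -
  interpret peaked_concave A P h by fact
  note ratio = cubic_ratio_eq_moments[OF assms]
  have int: "set_integrable lborel A (\<lambda>x. h x ^ 1 - h x ^ 3)"
    by (intro set_integral_diff integrable_moment)
  have diff: "moment 1 - moment 3 = (LINT x:A|lborel. h x ^ 1 - h x ^ 3)"
    unfolding moment_def by (rule set_integral_diff(2)[symmetric]; rule integrable_moment)
  have nn: "0 \<le> h x ^ 1 - h x ^ 3" if "x \<in> A" for x
    using power_decreasing[of 1 3 "h x"] h_nonneg[OF that] h_le_1[OF that] by simp
  have "0 \<le> moment 1 - moment 3"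
    unfolding diff set_lebesgue_integral_def
    using nn by (intro Bochner_Integration.integral_nonneg) (auto simp: indicator_def)
  then show "cubic_ratio A h \<le> 1"
    using moment_pos[of 1] by (simp add: ratio)
  show "cubic_ratio A h = 1 \<longleftrightarrow> (\<forall>x\<in>A. h x = 1)"
  proof
    assume "cubic_ratio A h = 1"
    then have "moment 1 - moment 3 = 0"
      using moment_pos[of 1] by (simp add: ratio)
    then have 0: "(LINT x:A|lborel. h x ^ 1 - h x ^ 3) = 0"
      by (simp only: diff)
    show "\<forall>x\<in>A. h x = 1"
    proof
      fix x assume x: "x \<in> A"
      have "h x ^ 1 - h x ^ 3 = 0"
        by (rule continuous_set_integral_eq_0[OF open_A _ int nn 0 x]) (intro continuous_intros)
      then have "h x * (1 - (h x)\<^sup>2) = 0"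
        by (simp add: power2_eq_square power3_eq_cube algebra_simps)
      then show "h x = 1"
        using h_pos[OF x] by (auto simp: power2_eq_1_iff)
    qed
  next
    assume "\<forall>x\<in>A. h x = 1"
    then have "moment 3 = moment 1"
      unfolding moment_def by (intro set_lebesgue_integral_cong) auto
    then show "cubic_ratio A h = 1"
      using moment_pos[of 1] by (simp add: ratio)
  qed
qed

text \<open>A normalized \<open>h\<close> may approach 1 only at the boundary, and then the extremal
  functions are cones with a boundary vertex, such as \<open>x\<close> on the interval from 0 to 1.
  The last conjunct is the case where the value 1 is attained in \<open>A\<close>, with interior
  vertices alone.\<close>

theorem proposition5p2:
  fixes A :: "(real^'n) set" and d :: nat
  assumes "d \<ge> 2" and "CARD('n) = d - 1"
    and "A \<noteq> {}" and "bounded A" and "open A" and "convex A"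
  shows "(\<forall>h. normalized_concave A h \<longrightarrow>
            6 / ((real d + 1) * (real d + 2)) \<le> cubic_ratio A h \<and> cubic_ratio A h \<le> 1)
       \<and> (\<exists>h. normalized_concave A h \<and> cubic_ratio A h = 6 / ((real d + 1) * (real d + 2)))
       \<and> (\<exists>h. normalized_concave A h \<and> cubic_ratio A h = 1)
       \<and> (\<forall>h. normalized_concave A h \<longrightarrow>
            (cubic_ratio A h = 1 \<longleftrightarrow> (\<forall>x\<in>A. h x = 1)))
       \<and> (\<forall>h. normalized_concave A h \<longrightarrow>
            (cubic_ratio A h = 6 / ((real d + 1) * (real d + 2)) \<longleftrightarrow>
               is_cone_function A h \<or> is_boundary_cone_function A h))
       \<and> (\<forall>h. normalized_concave A h \<and> (\<exists>x\<in>A. h x = 1) \<longrightarrow>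
            (cubic_ratio A h = 6 / ((real d + 1) * (real d + 2)) \<longleftrightarrow> is_cone_function A h))"
proof -
  let ?c = "6 / ((real d + 1) * (real d + 2))"
  \<comment> \<open>With \<open>n = d - 1\<close>, the factors \<open>n + 2\<close> and
    \<open>n + 3\<close> become \<open>d + 1\<close> and \<open>d + 2\<close>.\<close>
  have c: "?c = 6 / ((real CARD('n) + 2) * (real CARD('n) + 3))"
    using assms(1,2) by (simp add: of_nat_diff add_ac)
  have norm_iff: "normalized_concave A h \<longleftrightarrow>
      concave_on A h \<and> (\<forall>x\<in>A. 0 \<le> h x \<and> h x \<le> 1) \<and> (\<forall>c<1. \<exists>x\<in>A. c < h x)" for h
    using Linfty_norm_eq_1_iff[OF \<open>open A\<close> concave_on_continuous_open[OF \<open>open A\<close>], of h]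
    unfolding normalized_concave_def by blast
  have norm_if_max: "normalized_concave A h"
    if "concave_on A h" "\<forall>x\<in>A. 0 \<le> h x \<and> h x \<le> 1" "P \<in> A" "h P = 1" for h P
    using that unfolding norm_iff by (auto intro!: bexI[of _ P])
  have peak: "\<exists>P. peaked_concave A P h" if "normalized_concave A h" for h
    using peaked_concave_exists[OF assms(5,4,3), of h] that unfolding norm_iff by blast
  have peak_at: "peaked_concave A P h" if "normalized_concave A h" "P \<in> A" "h P = 1" for h P
    using peaked_concave_at_maximum[OF assms(5,4)] that unfolding norm_iff by blast
  have ge: "?c \<le> cubic_ratio A h" if "peaked_concave A P h" for P h
    using peaked_concave.moment_ratio_ge[OF that] cubic_ratio_eq_moments[OF that] c by simp
  have eq_iff: "cubic_ratio A h = ?c \<longleftrightarrow> (\<forall>x\<in>A. h x = cone_fun A P x)"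
    if "peaked_concave A P h" for P h
    using cubic_ratio_eq_iff_cone_fun[OF that] c by simp
  have eq_if_cone: "cubic_ratio A h = ?c"
    if "normalized_concave A h" "P \<in> closure A" "\<forall>x\<in>A. h x = cone_fun A P x" for h P
    using eq_iff[OF peaked_concave_cone_fun[OF assms(5,4,3) _ that(2) _ that(3)]] that
    unfolding norm_iff by blast
  have cl: "closure A = A \<union> frontier A"
    by (simp add: closure_Un_frontier)
  note cone_iffs = is_cone_function_iff[OF assms(5,4,6)] is_boundary_cone_function_iff[OF assms(4,6)]
  obtain P where P: "P \<in> A" using assms(3) by blast
  have PC: "P \<in> closure A" using P by (simp add: cl)
  have cone_norm: "normalized_concave A (cone_fun A P)"
  proof (rule norm_if_max[OF _ _ P])
    show "concave_on A (cone_fun A P)"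
      using concave_cone_fun[OF assms(4,6) PC] assms(6) closure_subset[of A] unfolding concave_on_iff by blast
    show "\<forall>x\<in>A. 0 \<le> cone_fun A P x \<and> cone_fun A P x \<le> 1"
      using cone_fun_bounds[OF assms(4)] closure_subset[of A] by blast
    show "cone_fun A P P = 1"
      by (rule cone_fun_vertex[OF assms(4) PC])
  qed
  have one_norm: "normalized_concave A (\<lambda>_. 1)"
    using P assms(6) by (intro norm_if_max[of _ P]) (auto simp: concave_on_iff)
  have le_1: "cubic_ratio A h \<le> 1" "cubic_ratio A h = 1 \<longleftrightarrow> (\<forall>x\<in>A. h x = 1)"
    if "normalized_concave A h" for h
    using peak[OF that] cubic_ratio_le_1 by blast+
  have cone: "cubic_ratio A h = ?c \<longleftrightarrow> is_cone_function A h \<or> is_boundary_cone_function A h"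
    if h: "normalized_concave A h" for h
  proof -
    obtain Q where Q: "peaked_concave A Q h"
      using peak[OF h] by blast
    \<comment> \<open>A vertex in the closure is either in \<open>A\<close> or on the frontier,
      which yields the two kinds of cone.\<close>
    have "(\<exists>P\<in>closure A. \<forall>x\<in>A. h x = cone_fun A P x) \<longleftrightarrow> is_cone_function A h \<or> is_boundary_cone_function A h"
      unfolding cone_iffs cl by blast
    then show ?thesis
      using eq_iff[OF Q] eq_if_cone[OF h] peaked_concave.P_closure[OF Q] by blast
  qed
  \<comment> \<open>Here the peak is the maximum point \<open>Q\<close> in \<open>A\<close>, so the
    cone in \<open>eq_iff\<close> has an interior vertex.\<close>
  have cone_max: "cubic_ratio A h = ?c \<longleftrightarrow> is_cone_function A h"
    if h: "normalized_concave A h" and "Q \<in> A" "h Q = 1" for h Q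
    using eq_iff[OF peak_at[OF that]] cone[OF h] \<open>Q \<in> A\<close> unfolding cone_iffs by blast
  show ?thesis
  proof (intro conjI allI impI)
    fix h assume h: "normalized_concave A h"
    show "?c \<le> cubic_ratio A h"
      using peak[OF h] ge by blast
    show "cubic_ratio A h \<le> 1" "cubic_ratio A h = 1 \<longleftrightarrow> (\<forall>x\<in>A. h x = 1)"
      by (rule le_1[OF h])+
    show "cubic_ratio A h = ?c \<longleftrightarrow> is_cone_function A h \<or> is_boundary_cone_function A h"
      by (rule cone[OF h])
  next
    show "\<exists>h. normalized_concave A h \<and> cubic_ratio A h = ?c"
      using cone_norm eq_if_cone[OF cone_norm PC] by blast
    show "\<exists>h. normalized_concave A h \<and> cubic_ratio A h = 1"
      using one_norm le_1(2)[OF one_norm] by blast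
  next
    fix h assume "normalized_concave A h \<and> (\<exists>x\<in>A. h x = 1)"
    then show "cubic_ratio A h = ?c \<longleftrightarrow> is_cone_function A h"
      using cone_max by blast
  qed
qed

end
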